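(* Let $1<q<p$, let $(X,\mu)$ be a non-atomic probability space and let $\mathcal{T}$ be a tree on $X$. Let $f>0$ and $A$ be real numbers such that $0<f^q<A$, and let $F$ be a real number with $0<f^p\le F$ satisfying $$\omega_p\Big(\frac{f^p}{F}\Big)=\omega_q\Big(\frac{f^q}{A}\Big).$$ Then $$B_{\mathcal{T}}^{p,q}(f,A,F)=\omega_q\Big(\frac{f^q}{A}\Big)^p F.$$
   Context: Let $(X,\mu)$ be a non-atomic probability space. Two measurable sets $A,B\subseteq X$ are almost disjoint if $\mu(A\cap B)=0$. A set $\mathcal{T}$ of measurable subsets of $X$ is called a tree if: (i) $X\in\mathcal{T}$ and $\mu(I)>0$ for every $I\in\mathcal{T}$; (ii) to every $I\in\mathcal{T}$ there corresponds a finite or countable subset $\mathcal{C}(I)\subseteq\mathcal{T}$ containing at least two elements such that (a) the elements of $\mathcal{C}(I)$ are pairwise almost disjoint subsets of $I$, and (b) $I=\bigcup\mathcal{C}(I)$; (iii) $\mathcal{T}=\bigcup_{m\ge 0}\mathcal{T}_{(m)}$, where $\mathcal{T}_{(0)}=\{X\}$ and $\mathcal{T}_{(m+1)}=\bigcup_{I\in\mathcal{T}_{(m)}}\mathcal{C}(I)$; (iv) $\lim_{m\to\infty}\sup_{I\in\mathcal{T}_{(m)}}\mu(I)=0$. For $\phi\in L^1(X,\mu)$ the associated maximal operator is $$\mathcal{M}_{\mathcal{T}}\phi(x)=\sup\Big\{\frac{1}{\mu(I)}\int_I|\phi|\,d\mu : x\in I\in\mathcal{T}\Big\}.$$ For $1<q<p$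 and $f,A,F$ with $f^q<A<F^{q/p}$, the Bellman function of three integral variables is $$B_{\mathcal{T}}^{p,q}(f,A,F)=\sup\Big\{\int_X(\mathcal{M}_{\mathcal{T}}\phi)^p\,d\mu : \phi\ge 0,\ \phi\in L^p(X,\mu),\ \int_X\phi\,d\mu=f,\ \int_X\phi^q\,d\mu=A,\ \int_X\phi^p\,d\mu=F\Big\}.$$ For $r>1$ (used with $r=p$ and $r=q$), let $H_r(z)=-(r-1)z^r+rz^{r-1}$ for $z\in[1,\frac{r}{r-1}]$; this is a strictly decreasing bijection onto $[0,1]$, and $\omega_r:[0,1]\to[1,\frac{r}{r-1}]$ denotes its inverse, $\omega_r=H_r^{-1}$. *)

theory Defs
  imports "HOL-Probability.Probability"
begin

definition non_atomic :: "'a measure \<Rightarrow> bool" where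
  "non_atomic M \<longleftrightarrow>
     (\<forall>A\<in>sets M. emeasure M A > 0 \<longrightarrow>
        (\<exists>B\<in>sets M. B \<subseteq> A \<and> 0 < emeasure M B \<and> emeasure M B < emeasure M A))"

definition almost_disjoint :: "'a measure \<Rightarrow> 'a set \<Rightarrow> 'a set \<Rightarrow> bool" where
  "almost_disjoint M A B \<longleftrightarrow> emeasure M (A \<inter> B) = 0"

primrec tree_level :: "'a measure \<Rightarrow> ('a set \<Rightarrow> 'a set set) \<Rightarrow> nat \<Rightarrow> 'a set set" where
  "tree_level M C 0 = {space M}"
| "tree_level M C (Suc m) = (\<Union>I\<in>tree_level M C m. C I)"

definition is_tree :: "'a measure \<Rightarrow> 'a set set \<Rightarrow> bool" where
  "is_tree M T \<longleftrightarrow>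
     T \<subseteq> sets M \<and> space M \<in> T \<and> (\<forall>I\<in>T. emeasure M I > 0) \<and>
     (\<exists>C :: 'a set \<Rightarrow> 'a set set.
        (\<forall>I\<in>T. C I \<subseteq> T \<and> countable (C I) \<and> (\<exists>J\<in>C I. \<exists>K\<in>C I. J \<noteq> K) \<and>
           (\<forall>J\<in>C I. J \<subseteq> I) \<and> pairwise (almost_disjoint M) (C I) \<and> I = \<Union>(C I)) \<and>
        T = (\<Union>m. tree_level M C m) \<and>
        (\<lambda>m. SUP I\<in>tree_level M C m. emeasure M I) \<longlonglongrightarrow> 0)"

(* The maximal function may take the value \<infinity>, hence the codomain ennreal. *)
definition maximal_op :: "'a measure \<Rightarrow> 'a set set \<Rightarrow> ('a \<Rightarrow> real) \<Rightarrow> 'a \<Rightarrow> ennreal" where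
  "maximal_op M T \<phi> x =
     (SUP I\<in>{I\<in>T. x \<in> I}. (\<integral>\<^sup>+y\<in>I. ennreal \<bar>\<phi> y\<bar> \<partial>M) / emeasure M I)"

(* Real powers on [0,\<infinity>], for exponents p > 0, where \<infinity> to the power p is \<infinity>. *)
definition ennreal_powr :: "ennreal \<Rightarrow> real \<Rightarrow> ennreal" where
  "ennreal_powr x p = (if x = \<infinity> then \<infinity> else ennreal (enn2real x powr p))"

(* The supremum is taken in [0,\<infinity>], so it is 0 if no \<phi> is admissible. For admissible \<phi>,
   \<phi> and its q-th power are integrable because M is a probability measure and 1 < q < p. *)
definition bellman ::
    "'a measure \<Rightarrow> 'a set set \<Rightarrow> real \<Rightarrow> real \<Rightarrow> real \<Rightarrow> real \<Rightarrow> real \<Rightarrow> ennreal" where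
  "bellman M T p q f A F =
     Sup {\<integral>\<^sup>+x. ennreal_powr (maximal_op M T \<phi> x) p \<partial>M | \<phi> :: 'a \<Rightarrow> real.
            (\<forall>x\<in>space M. \<phi> x \<ge> 0) \<and>
            \<phi> \<in> borel_measurable M \<and> integrable M (\<lambda>x. \<bar>\<phi> x\<bar> powr p) \<and>
            (\<integral>x. \<phi> x \<partial>M) = f \<and> (\<integral>x. \<phi> x powr q \<partial>M) = A \<and> (\<integral>x. \<phi> x powr p \<partial>M) = F}"

definition H_fun :: "real \<Rightarrow> real \<Rightarrow> real" where
  "H_fun r z = - (r - 1) * z powr r + r * z powr (r - 1)"

definition omega :: "real \<Rightarrow> real \<Rightarrow> real" where
  "omega r = the_inv_into {1..r / (r - 1)} (H_fun r)"

end

theory Submission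
  imports Defs
begin

text \<open>
  Put \<open>a = \<omega>\<^sub>q(f\<^sup>q/A) = \<omega>\<^sub>p(f\<^sup>p/F)\<close>, so that \<open>f\<^sup>q = A H\<^sub>q(a)\<close> and \<open>f\<^sup>p = F H\<^sub>p(a)\<close>.

  Upper bound: for \<open>m = min(\<M>\<phi>, N)\<close> the weak type inequality and the layer cake formula give
  \<open>\<integral> m\<^sup>p \<le> f\<^sup>p + p/(p-1) \<integral> \<phi> (m\<^sup>p\<^sup>-\<^sup>1 - f\<^sup>p\<^sup>-\<^sup>1)\<close>. Applying Young's inequality to \<open>\<phi> m\<^sup>p\<^sup>-\<^sup>1\<close>,
  weighted so that equality holds for \<open>m = a\<phi>\<close>, and inserting \<open>f\<^sup>p = F H\<^sub>p(a)\<close> yields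
  \<open>\<integral> m\<^sup>p \<le> a\<^sup>p F\<close>; then \<open>N \<rightarrow> \<infinity>\<close>.

  Lower bound: the decreasing function \<open>g(t) = (f/a) t^(1/a - 1)\<close> on \<open>(0,1]\<close> has
  \<open>s\<close>-th moment \<open>f\<^sup>s/H\<^sub>s(a)\<close>, hence meets the constraints for \<open>s = 1, q, p\<close> at the same time, and its
  average over \<open>(0,t]\<close> is \<open>a g(t)\<close>. Given \<open>0 < b < 1\<close>, each tree element contains an almost disjoint
  subfamily filling exactly the fraction \<open>b\<close> of it; iterating this gives nested sets \<open>A\<^sub>k\<close> of measure
  \<open>b\<^sup>k\<close>. For a uniformly distributed \<open>V\<close> with \<open>V \<le> b\<^sup>k\<close> on \<open>A\<^sub>k\<close> and \<open>V \<ge> b\<^sup>k\<close> off \<open>A\<^sub>k\<close>, the function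
  \<open>\<phi> = g \<circ> V\<close> satisfies the constraints exactly and \<open>\<M>\<phi> \<ge> \<rho>(b) \<phi>\<close> almost everywhere, where
  \<open>\<rho>(b) \<rightarrow> a\<close> as \<open>b \<rightarrow> 1\<close>.
\<close>

subsection \<open>Measure-theoretic preliminaries\<close>

text \<open>The overlaps form a countable union \<open>Z\<close> of null sets. Removing
  \<open>Z\<close> makes the family disjoint and changes no measure, so ordinary countable
  additivity applies.\<close>

lemma emeasure_UN_almost_disjoint:
  assumes I: "countable I" and X: "\<And>i. i \<in> I \<Longrightarrow> X i \<in> sets N"
    and null: "\<And>i j. i \<in> I \<Longrightarrow> j \<in> I \<Longrightarrow> i \<noteq> j \<Longrightarrow> emeasure N (X i \<inter> X j) = 0"
  shows "emeasure N (\<Union>i\<in>I. X i) = (\<integral>\<^sup>+i. emeasure N (X i) \<partial>count_space I)"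
proof -
  define Z where "Z = (\<Union>i\<in>I. \<Union>j\<in>I - {i}. X i \<inter> X j)"
  have Z: "Z \<in> null_sets N"
    unfolding Z_def using I X null by (intro null_sets_UN') (auto intro!: null_setsI)
  have "emeasure N (\<Union>i\<in>I. X i) = emeasure N ((\<Union>i\<in>I. X i) - Z)"
    using I X by (intro emeasure_Diff_null_set[OF Z, symmetric] sets.countable_UN'') auto
  also have "(\<Union>i\<in>I. X i) - Z = (\<Union>i\<in>I. X i - Z)"
    by auto
  also have "emeasure N \<dots> = (\<integral>\<^sup>+i. emeasure N (X i - Z) \<partial>count_space I)"
    using I X Z by (intro emeasure_UN_countable) (auto simp: disjoint_family_on_def Z_def)
  also have "\<dots> = (\<integral>\<^sup>+i. emeasure N (X i) \<partial>count_space I)"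
    using X by (intro nn_integral_cong) (simp add: emeasure_Diff_null_set[OF Z])
  finally show ?thesis .
qed

text \<open>Without atoms the cdf is continuous. For \<open>0 < v < 1\<close> the sublevel set of
  the cdf at \<open>v\<close> is then a closed half-line at whose endpoint the cdf equals
  \<open>v\<close>, so its measure is \<open>v\<close>.\<close>

lemma (in real_distribution) probability_integral_transform:
  assumes no_atoms: "\<And>x. measure M {x} = 0"
  shows "distr M borel (cdf M) = uniform_measure lborel {0..1}"
proof (rule cdf_unique)
  have cont: "isCont (cdf M) x" for x
    using isCont_cdf[of x] no_atoms[of x] by blast
  then have cont': "continuous_on UNIV (cdf M)"
    by (simp add: continuous_on_eq_continuous_at)
  have cdf_borel: "cdf M \<in> borel_measurable borel"
    using cont' by (rule borel_measurable_continuous_onI)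
  have [measurable]: "cdf M \<in> borel_measurable M"
    by (subst measurable_cong_sets[OF M_is_borel refl]) (rule cdf_borel)
  show D: "real_distribution (distr M borel (cdf M))"
    by (rule real_distribution_distr) fact
  interpret D: real_distribution "distr M borel (cdf M)" by fact
  interpret U: prob_space "uniform_measure lborel {0..1::real}"
    by (rule prob_space_uniform_measure) auto
  show U: "real_distribution (uniform_measure lborel {0..1})"
    by unfold_locales auto
  interpret U: real_distribution "uniform_measure lborel {0..1}" by fact
  have cdfU: "cdf (uniform_measure lborel {0..1}) v = min 1 v" if "0 \<le> v" for v :: real
  proof -
    have "{0..1} \<inter> {..v} = {0..min 1 v}" by auto
    then show ?thesis using that by (simp add: cdf_def measure_uniform_measure)
  qed
  have Dcdf: "cdf (distr M borel (cdf M)) v = measure M {x. cdf M x \<le> v}" for v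
    unfolding cdf_def2[of "distr M borel (cdf M)"]
    by (subst measure_distr) (auto intro!: arg_cong[where f = prob])
  have mid: "measure M {x. cdf M x \<le> v} = v" if v: "0 < v" "v < 1" for v
  proof -
    define S where "S = {x. cdf M x \<le> v}"
    have "eventually (\<lambda>x. cdf M x < v) at_bot"
      using cdf_lim_at_bot v by (intro order_tendstoD) auto
    then obtain b where b: "cdf M b < v"
      by (auto simp: eventually_at_bot_linorder)
    then have ne: "S \<noteq> {}" unfolding S_def using less_imp_le by blast
    have "eventually (\<lambda>x. cdf M x > v) at_top"
      using cdf_lim_at_top_prob v by (intro order_tendstoD) auto
    then obtain c where c: "\<And>x. x \<ge> c \<Longrightarrow> cdf M x > v"
      by (auto simp: eventually_at_top_linorder)
    have bdd: "bdd_above S"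
    proof (rule bdd_aboveI[of _ c])
      fix x assume "x \<in> S"
      then show "x \<le> c" using c[of x] by (simp add: S_def) (meson linorder_not_less nle_le)
    qed
    have "closed S" unfolding S_def
      using cont' by (intro closed_Collect_le continuous_intros) auto
    then have Sup: "Sup S \<in> S" using ne bdd by (intro closed_contains_Sup)
    have S_eq: "S = {..Sup S}"
    proof safe
      fix x assume "x \<in> S" then show "x \<le> Sup S" using bdd by (rule cSup_upper)
    next
      fix x assume "x \<le> Sup S"
      then have "cdf M x \<le> cdf M (Sup S)" by (rule cdf_nondecreasing)
      with Sup show "x \<in> S" by (auto simp: S_def)
    qed
    have "\<exists>x. b \<le> x \<and> x \<le> c \<and> cdf M x = v"
    proof (rule IVT)
      have "b < c" using b c[of b] by (meson linorder_not_less order_less_asym)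
      then show "b \<le> c" by simp
    qed (use b c[of c] cont in auto)
    then obtain x where x: "cdf M x = v" by auto
    then have "x \<in> S" by (simp add: S_def)
    then have "v \<le> cdf M (Sup S)" using bdd x cdf_nondecreasing cSup_upper by metis
    with Sup have "cdf M (Sup S) = v" by (simp add: S_def)
    then have "measure M S = v" by (subst S_eq) (simp add: cdf_def)
    then show ?thesis by (simp add: S_def)
  qed
  show "cdf (distr M borel (cdf M)) = cdf (uniform_measure lborel {0..1})"
  proof
    fix v :: real
    consider "v < 0" | "v = 0" | "0 < v" "v < 1" | "1 \<le> v" by linarith
    then show "cdf (distr M borel (cdf M)) v = cdf (uniform_measure lborel {0..1}) v"
    proof cases
      case 1
      then have "{x. cdf M x \<le> v} = {}" using cdf_nonneg by (auto simp: not_le intro: less_le_trans)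
      moreover have "{0..1} \<inter> {..v} = {}" using 1 by auto
      ultimately show ?thesis by (simp add: Dcdf cdf_def[of "uniform_measure _ _"] measure_uniform_measure)
    next
      \<comment> \<open>The sublevel set at 0 may be empty and then has no supremum to work with;
        the value comes from monotonicity and \<open>mid\<close> at arbitrarily small
        levels.\<close>
      case 2
      have "cdf (distr M borel (cdf M)) 0 \<le> e" if "0 < e" for e
      proof -
        define e' where "e' = min e (1/2)"
        have e': "0 < e'" "e' < 1" "e' \<le> e" using that by (auto simp: e'_def)
        have "cdf (distr M borel (cdf M)) 0 \<le> cdf (distr M borel (cdf M)) e'"
          using e' by (intro D.cdf_nondecreasing) auto
        also have "\<dots> = e'" using mid[OF e'(1,2)] by (simp add: Dcdf)
        finally show ?thesis using e' by simp
      qed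
      then have "cdf (distr M borel (cdf M)) 0 \<le> 0" by (rule field_le_epsilon[of _ 0, simplified])
      with D.cdf_nonneg[of 0] show ?thesis using 2 by (simp add: cdfU)
    next
      case 3
      then show ?thesis using mid[of v] by (simp add: Dcdf cdfU)
    next
      case 4
      then have "{x. cdf M x \<le> v} = space M"
        using cdf_bounded_prob order_trans by (auto simp: borel_UNIV)
      then show ?thesis using 4 prob_space by (simp add: Dcdf cdfU)
    qed
  qed
qed

section \<open>Ternary expansions with digits 0 and 1\<close>

lemma ternary_sums: "(\<lambda>k. (1/3::real) ^ Suc k) sums (1/2)"
  using sums_mult[OF geometric_sums[of "1/3::real"], of "1/3"] by simp

lemma summable_ternary_indicator: "summable (\<lambda>k. indicator R k * (1/3::real) ^ Suc k)"
  by (rule summable_comparison_test'[OF sums_summable[OF ternary_sums], of 0]) (auto simp: indicator_def)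

text \<open>At the first index \<open>n\<close> where the digits differ, the difference is
  \<open>(1/3) ^ Suc n\<close>, while all later digits together change the sum by at most half of
  that. In base 2 the tail could compensate exactly.\<close>

lemma ternary_expansion_inj:
  fixes S S' :: "nat set"
  assumes eq: "(\<Sum>k. indicator S k * (1/3::real) ^ Suc k) = (\<Sum>k. indicator S' k * (1/3) ^ Suc k)"
  shows "S = S'"
proof (rule ccontr)
  assume "S \<noteq> S'"
  define d :: "nat \<Rightarrow> real" where "d = (\<lambda>k. indicator S k - indicator S' k)"
  note sg = sums_summable[OF ternary_sums] and su = summable_ternary_indicator
  have sd: "summable (\<lambda>k. d k * (1/3) ^ Suc k)"
    unfolding d_def left_diff_distrib by (intro summable_diff su)
  have zero: "(\<Sum>k. d k * (1/3) ^ Suc k) = 0"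
    unfolding d_def left_diff_distrib using suminf_diff[OF su[of S] su[of S']] eq by linarith
  define n where "n = (LEAST k. d k \<noteq> 0)"
  have "\<exists>k. d k \<noteq> 0" using \<open>S \<noteq> S'\<close> by (auto simp: d_def indicator_def split: if_splits)
  then have n: "d n \<noteq> 0" unfolding n_def by (rule LeastI_ex)
  have before: "d k = 0" if "k < n" for k using that not_less_Least n_def by blast
  have d1: "\<bar>d k\<bar> \<le> 1" for k by (auto simp: d_def indicator_def)
  have dn: "\<bar>d n\<bar> = 1" using n by (auto simp: d_def indicator_def split: if_splits)
  have "(\<Sum>k. d k * (1/3) ^ Suc k) = (\<Sum>k. d (k + Suc n) * (1/3) ^ Suc (k + Suc n)) + (\<Sum>k<Suc n. d k * (1/3) ^ Suc k)"
    by (rule suminf_split_initial_segment[OF sd])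
  also have "(\<Sum>k<Suc n. d k * (1/3) ^ Suc k) = d n * (1/3) ^ Suc n"
    using before by simp
  finally have "\<bar>d n * (1/3) ^ Suc n\<bar> = \<bar>\<Sum>k. d (k + Suc n) * (1/3) ^ Suc (k + Suc n)\<bar>"
    using zero by linarith
  also have "\<dots> \<le> (\<Sum>k. (1/3) ^ Suc (k + Suc n))"
  proof -
    have s1: "summable (\<lambda>k. (1/3::real) ^ Suc (k + Suc n))"
      using summable_ignore_initial_segment[OF sg, of "Suc n"] by simp
    have le: "\<bar>d (k + Suc n) * (1/3) ^ Suc (k + Suc n)\<bar> \<le> (1/3) ^ Suc (k + Suc n)" for k
      using d1 by (simp add: abs_mult mult_left_le_one_le)
    have s2: "summable (\<lambda>k. \<bar>d (k + Suc n) * (1/3) ^ Suc (k + Suc n)\<bar>)"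
      by (rule summable_comparison_test'[OF s1, of 0]) (use le in auto)
    show ?thesis
      using summable_rabs[OF s2] suminf_le[OF le s2 s1] by linarith
  qed
  also have "\<dots> = (1/3) ^ Suc n * (\<Sum>k. (1/3) ^ Suc k)"
    using suminf_mult[OF sg, of "(1/3) ^ Suc n"] by (simp add: power_add mult_ac)
  also have "(\<Sum>k. (1/3::real) ^ Suc k) = 1/2"
    by (rule sums_unique[OF ternary_sums, symmetric])
  finally show False using dn by (simp add: abs_mult)
qed

text \<open>Both sides are integrals over the levels \<open>l\<close> from \<open>f\<close> up to
  \<open>m x\<close>. After Fubini, the integrands at level \<open>l\<close> compare by the weak
  type inequality multiplied by \<open>p * l powr (p - 2)\<close>.\<close>

lemma nn_integral_layer_cake_powr_le:
  fixes m \<phi> :: "'a \<Rightarrow> real"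
  assumes "sigma_finite_measure M" and p: "1 < p" and f: "0 < f"
    and [measurable]: "m \<in> borel_measurable M" "\<phi> \<in> borel_measurable M"
    and m: "\<And>x. x \<in> space M \<Longrightarrow> f \<le> m x"
    and weak: "\<And>l. f \<le> l \<Longrightarrow>
      ennreal l * emeasure M {x\<in>space M. l < m x} \<le> (\<integral>\<^sup>+x\<in>{x\<in>space M. l < m x}. ennreal (\<phi> x) \<partial>M)"
  shows "(\<integral>\<^sup>+x. ennreal (m x powr p - f powr p) \<partial>M) \<le>
    (\<integral>\<^sup>+x. ennreal (\<phi> x) * ennreal (p / (p - 1) * (m x powr (p - 1) - f powr (p - 1))) \<partial>M)"
proof -
  interpret sigma_finite_measure M by fact
  interpret P: pair_sigma_finite M lborel ..
  \<comment> \<open>Used with \<open>s = p\<close>, \<open>c = 1\<close> on the left and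
    \<open>s = p - 1\<close>, \<open>c = p / (p - 1)\<close> on the right, so that
    \<open>c * s = p\<close> both times. The interval is half-open to match the strict level sets;
    the endpoint is a null set.\<close>
  have powr_diff: "ennreal (c * (y powr s - f powr s)) =
      (\<integral>\<^sup>+l. ennreal (c * s * l powr (s - 1)) * indicator {l. f \<le> l \<and> l < y} l \<partial>lborel)"
    if "f \<le> y" "0 < s" "0 < c" for y s c :: real
  proof -
    have "(\<integral>\<^sup>+l. ennreal (c * s * l powr (s - 1)) * indicator {f..y} l \<partial>lborel)
        = ennreal (c * y powr s - c * f powr s)"
    proof (rule nn_integral_FTC_Icc)
      fix x assume "x \<in> {f..y}"
      then have "0 < x" using f by auto
      then show "((\<lambda>x. c * x powr s) has_real_derivative c * s * x powr (s - 1)) (at x)"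
        by (auto intro!: derivative_eq_intros)
    qed (use that in auto)
    moreover have "(\<integral>\<^sup>+l. ennreal (c * s * l powr (s - 1)) * indicator {l. f \<le> l \<and> l < y} l \<partial>lborel)
      = (\<integral>\<^sup>+l. ennreal (c * s * l powr (s - 1)) * indicator {f..y} l \<partial>lborel)"
      using AE_lborel_singleton[of y]
      by (intro nn_integral_cong_AE) (auto elim!: eventually_mono simp: indicator_def)
    ultimately show ?thesis by (simp add: algebra_simps)
  qed
  have "(\<integral>\<^sup>+x. ennreal (m x powr p - f powr p) \<partial>M) =
     (\<integral>\<^sup>+x. \<integral>\<^sup>+l. ennreal (p * l powr (p - 1)) * indicator {l. f \<le> l \<and> l < m x} l \<partial>lborel \<partial>M)"
    using powr_diff[of _ p 1] m p by (intro nn_integral_cong) simp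
  also have "\<dots> = (\<integral>\<^sup>+l. \<integral>\<^sup>+x. ennreal (p * l powr (p - 1)) * indicator {l. f \<le> l \<and> l < m x} l \<partial>M \<partial>lborel)"
    by (rule P.Fubini'[symmetric]) measurable
  also have "\<dots> \<le> (\<integral>\<^sup>+l. \<integral>\<^sup>+x. ennreal (\<phi> x) * (ennreal (p * l powr (p - 2)) * indicator {l. f \<le> l \<and> l < m x} l) \<partial>M \<partial>lborel)"
  proof (rule nn_integral_mono)
    fix l :: real
    show "(\<integral>\<^sup>+x. ennreal (p * l powr (p - 1)) * indicator {l. f \<le> l \<and> l < m x} l \<partial>M)
      \<le> (\<integral>\<^sup>+x. ennreal (\<phi> x) * (ennreal (p * l powr (p - 2)) * indicator {l. f \<le> l \<and> l < m x} l) \<partial>M)"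
    proof (cases "f \<le> l")
      case True
      have l: "p * l powr (p - 1) = p * l powr (p - 2) * l"
        using True f powr_mult_base[of l "p - 2"] by (simp add: mult_ac)
      have "(\<integral>\<^sup>+x. ennreal (p * l powr (p - 1)) * indicator {l. f \<le> l \<and> l < m x} l \<partial>M)
        = (\<integral>\<^sup>+x. ennreal (p * l powr (p - 1)) * indicator {x\<in>space M. l < m x} x \<partial>M)"
        using True by (intro nn_integral_cong) (auto simp: indicator_def)
      also have "\<dots> = ennreal (p * l powr (p - 2)) * (ennreal l * emeasure M {x\<in>space M. l < m x})"
        using True f p by (subst nn_integral_cmult_indicator) (auto simp: l ennreal_mult mult_ac)
      also have "\<dots> \<le> ennreal (p * l powr (p - 2)) * (\<integral>\<^sup>+x\<in>{x\<in>space M. l < m x}. ennreal (\<phi> x) \<partial>M)"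
        by (intro mult_left_mono weak True) auto
      also have "\<dots> = (\<integral>\<^sup>+x. ennreal (p * l powr (p - 2)) * (ennreal (\<phi> x) * indicator {x\<in>space M. l < m x} x) \<partial>M)"
        by (subst nn_integral_cmult) auto
      also have "\<dots> = (\<integral>\<^sup>+x. ennreal (\<phi> x) * (ennreal (p * l powr (p - 2)) * indicator {l. f \<le> l \<and> l < m x} l) \<partial>M)"
        using True by (intro nn_integral_cong) (auto simp: indicator_def mult_ac)
      finally show ?thesis .
    qed simp
  qed
  also have "\<dots> = (\<integral>\<^sup>+x. \<integral>\<^sup>+l. ennreal (\<phi> x) * (ennreal (p * l powr (p - 2)) * indicator {l. f \<le> l \<and> l < m x} l) \<partial>lborel \<partial>M)"
    by (rule P.Fubini') measurable
  also have "\<dots> = (\<integral>\<^sup>+x. ennreal (\<phi> x) * ennreal (p / (p - 1) * (m x powr (p - 1) - f powr (p - 1))) \<partial>M)"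
    using powr_diff[of _ "p - 1" "p / (p - 1)"] m p
    by (intro nn_integral_cong) (simp add: nn_integral_cmult)
  finally show ?thesis .
qed

text \<open>Young's inequality with exponents \<open>p\<close> and \<open>p / (p - 1)\<close> for
  the factors \<open>s * u\<close> and \<open>y powr (p - 1) / s\<close>. The weight
  \<open>s\<close> is chosen so that equality occurs for \<open>y = a * u\<close>, the relation
  between the maximal function and an ideal extremal function.\<close>

lemma powr_Young:
  fixes a p u y :: real
  assumes p: "1 < p" and a: "0 < a" and u: "0 \<le> u" and y: "0 \<le> y"
  shows "p / (p - 1) * (u * y powr (p - 1)) \<le> a powr (p - 1) / (p - 1) * u powr p + y powr p / a"
proof -
  define s where "s = a powr ((p - 1) / p)"
  have s: "s > 0" using a by (simp add: s_def)
  have "(s * u) * (y powr (p - 1) / s) \<le> (s * u) powr p / p + (y powr (p - 1) / s) powr (p / (p - 1)) / (p / (p - 1))"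
    by (rule Youngs_inequality) (use p u s in \<open>auto simp: field_simps\<close>)
  moreover have "(s * u) powr p = a powr (p - 1) * u powr p"
    using p a u by (simp add: s_def powr_mult powr_powr)
  moreover have "(y powr (p - 1) / s) powr (p / (p - 1)) = y powr p / a"
    using p a y by (simp add: s_def powr_divide powr_powr)
  moreover have "(s * u) * (y powr (p - 1) / s) = u * y powr (p - 1)"
    using s by simp
  ultimately have "u * y powr (p - 1) \<le> 1 / p * (a powr (p - 1) * u powr p) + (p - 1) / p * (y powr p / a)"
    using p by (simp add: mult.commute)
  then have "p / (p - 1) * (u * y powr (p - 1)) \<le>
      p / (p - 1) * (1 / p * (a powr (p - 1) * u powr p) + (p - 1) / p * (y powr p / a))"
    using p by (intro mult_left_mono) auto
  also have "\<dots> = a powr (p - 1) / (p - 1) * u powr p + y powr p / a"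
    using p a by (simp add: field_simps)
  finally show ?thesis .
qed

text \<open>Lets the upper bound be proved for bounded real truncations and then passed on by
  monotone convergence. Starting at height \<open>f\<close> keeps every truncation of a maximal
  function at least \<open>f\<close>.\<close>

lemma ennreal_powr_eq_SUP_truncation:
  assumes p: "1 \<le> p" and f: "0 \<le> f"
  shows "ennreal_powr y p = (SUP n. ennreal (enn2real (min y (ennreal (f + real n))) powr p))"
proof (cases y)
  case top
  have "(SUP n. ennreal (enn2real (min y (ennreal (f + real n))) powr p)) = top"
  proof (rule ennreal_SUP_eq_top)
    fix n :: nat
    have "real n \<le> (f + real (Suc n)) powr 1" using f by simp
    also have "\<dots> \<le> (f + real (Suc n)) powr p" using f p by (intro powr_mono) auto
    finally have "of_nat n \<le> ennreal ((f + real (Suc n)) powr p)"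
      by (simp add: ennreal_of_nat_eq_real_of_nat ennreal_leI)
    then show "\<exists>i\<in>UNIV. of_nat n \<le> ennreal (enn2real (min y (ennreal (f + real i))) powr p)"
      using top f by (intro bexI[of _ "Suc n"]) (simp_all del: of_nat_Suc ennreal_plus add: min_absorb2)
  qed
  moreover have "ennreal_powr y p = top" using top by (simp add: ennreal_powr_def)
  ultimately show ?thesis by (simp only:)
next
  case (real r)
  have m: "enn2real (min y (ennreal (f + real n))) = min r (f + real n)" for n
    using real f by (auto simp: min_def ennreal_le_iff simp del: ennreal_plus)
  have le: "ennreal (min r (f + real n) powr p) \<le> ennreal (r powr p)" for n
    using real f p by (intro ennreal_leI powr_mono2) auto
  obtain n where "r \<le> real n" using real_arch_simple by blast
  then have n: "min r (f + real n) = r" using f by auto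
  have "(SUP n. ennreal (min r (f + real n) powr p)) = ennreal (r powr p)"
    by (intro antisym SUP_least le SUP_upper2[of n]) (auto simp: n)
  moreover have "ennreal_powr y p = ennreal (r powr p)" using real by (simp add: ennreal_powr_def)
  ultimately show ?thesis by (simp only: m)
qed

subsection \<open>The maximal operator of a tree\<close>

text \<open>Fixes one witness \<open>C\<close> of the existential in \<open>is_tree\<close>, so that
  levels and recursions along children refer to the same choice throughout.\<close>

locale tree_prob_space = prob_space M for M :: "'a measure" +
  fixes T :: "'a set set" and C :: "'a set \<Rightarrow> 'a set set"
  assumes T_sets: "I \<in> T \<Longrightarrow> I \<in> sets M"
    and space_T: "space M \<in> T"
    and T_pos: "I \<in> T \<Longrightarrow> emeasure M I > 0"
    and C_T: "I \<in> T \<Longrightarrow> C I \<subseteq> T"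
    and C_countable: "I \<in> T \<Longrightarrow> countable (C I)"
    and C_subset: "I \<in> T \<Longrightarrow> J \<in> C I \<Longrightarrow> J \<subseteq> I"
    and C_disjoint: "I \<in> T \<Longrightarrow> J \<in> C I \<Longrightarrow> K \<in> C I \<Longrightarrow> J \<noteq> K \<Longrightarrow> emeasure M (J \<inter> K) = 0"
    and C_Union: "I \<in> T \<Longrightarrow> \<Union>(C I) = I"
    and T_levels: "T = (\<Union>m. tree_level M C m)"
    and level_small: "(\<lambda>m. SUP I\<in>tree_level M C m. emeasure M I) \<longlonglongrightarrow> 0"
begin

lemma level_T: "I \<in> tree_level M C m \<Longrightarrow> I \<in> T"
  using T_levels by auto

lemma countable_T: "countable T"
proof -
  have "countable (tree_level M C m)" for m
    by (induction m) (auto intro!: countable_UN C_countable level_T)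
  then show ?thesis by (subst T_levels) auto
qed

lemma level_cover: "x \<in> space M \<Longrightarrow> \<exists>I\<in>tree_level M C m. x \<in> I"
proof (induction m)
  case (Suc m)
  then obtain I where I: "I \<in> tree_level M C m" "x \<in> I" by auto
  then obtain J where "J \<in> C I" "x \<in> J" using C_Union[OF level_T[OF I(1)]] by blast
  with I show ?case by auto
qed auto

text \<open>The index set of the defining supremum varies with \<open>x\<close>. Multiplying the
  averages by indicators turns it into a supremum of measurable functions over the fixed countable
  set \<open>T\<close>.\<close>

lemma measurable_maximal_op [measurable]:
  "maximal_op M T \<phi> \<in> borel_measurable M"
proof -
  have "maximal_op M T \<phi> x =
      (SUP I\<in>T. (\<integral>\<^sup>+y\<in>I. ennreal \<bar>\<phi> y\<bar> \<partial>M) / emeasure M I * indicator I x)" (is "_ = ?r x") for x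
    unfolding maximal_op_def
  proof (rule antisym)
    show "(SUP I\<in>{I \<in> T. x \<in> I}. (\<integral>\<^sup>+y\<in>I. ennreal \<bar>\<phi> y\<bar> \<partial>M) / emeasure M I) \<le> ?r x"
      by (rule SUP_mono) (auto intro!: bexI simp: indicator_def)
    show "?r x \<le> (SUP I\<in>{I \<in> T. x \<in> I}. (\<integral>\<^sup>+y\<in>I. ennreal \<bar>\<phi> y\<bar> \<partial>M) / emeasure M I)"
      by (rule SUP_least) (auto simp: indicator_def intro: SUP_upper)
  qed
  then have "maximal_op M T \<phi> = ?r" by auto
  moreover have "?r \<in> borel_measurable M"
    by (intro borel_measurable_SUP countable_T) (use T_sets in auto)
  ultimately show ?thesis by simp
qed

text \<open>
  The union of those elements of \<open>G\<close> that descend from \<open>I\<close> through at most \<open>n\<close> generations. Since the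
  recursion stops at the first element of \<open>G\<close>, the weak type inequality follows by induction on the
  depth, without selecting maximal elements.
\<close>

primrec stopped :: "'a set set \<Rightarrow> nat \<Rightarrow> 'a set \<Rightarrow> 'a set" where
  "stopped G 0 I = (if I \<in> G then I else {})"
| "stopped G (Suc n) I = (if I \<in> G then I else (\<Union>J\<in>C I. stopped G n J))"

lemma stopped_subset: "I \<in> T \<Longrightarrow> stopped G n I \<subseteq> I"
proof (induction n arbitrary: I)
  case (Suc n)
  have "stopped G n J \<subseteq> I" if "J \<in> C I" for J
    using Suc.IH[of J] C_T[OF Suc.prems] C_subset[OF Suc.prems that] that by blast
  then show ?case by auto
qed auto

lemma stopped_sets: "I \<in> T \<Longrightarrow> stopped G n I \<in> sets M"
proof (induction n arbitrary: I)
  case (Suc n)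
  then show ?case using C_T C_countable T_sets by (auto intro!: sets.countable_UN'')
qed (auto simp: T_sets)

lemma stopped_Suc: "I \<in> T \<Longrightarrow> stopped G n I \<subseteq> stopped G (Suc n) I"
proof (induction n arbitrary: I)
  case (Suc n)
  have "stopped G n J \<subseteq> stopped G (Suc n) J" if "J \<in> C I" for J
    using Suc.IH C_T[OF Suc.prems] that by blast
  then show ?case unfolding stopped.simps(2)[of G n I] stopped.simps(2)[of G "Suc n" I]
    by (auto simp del: stopped.simps)
qed auto

lemma stopped_subset_Union: "stopped G n I \<subseteq> \<Union>G"
  by (induction n arbitrary: I) (auto split: if_splits)

text \<open>Each passage to the parent costs one generation. If the parent belongs to
  \<open>G\<close>, it is taken whole and contains the stopped set anyway.\<close>

lemma stopped_le_root: "I \<in> tree_level M C k \<Longrightarrow> stopped G n I \<subseteq> stopped G (k + n) (space M)"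
proof (induction k arbitrary: I n)
  case (Suc k)
  then obtain I' where I': "I' \<in> tree_level M C k" "I \<in> C I'" by auto
  have "I \<in> T" "I' \<in> T" using Suc.prems I' level_T by blast+
  then have "stopped G n I \<subseteq> stopped G (Suc n) I'"
    using stopped_subset[of I G n] C_subset[of I' I] I' by auto
  then show ?case using Suc.IH[OF I'(1), of "Suc n"] by auto
qed auto

lemma Union_stopped:
  assumes "G \<subseteq> T"
  shows "(\<Union>n. stopped G n (space M)) = \<Union>G"
proof (rule antisym)
  show "(\<Union>n. stopped G n (space M)) \<subseteq> \<Union>G" by (intro UN_least stopped_subset_Union)
  show "\<Union>G \<subseteq> (\<Union>n. stopped G n (space M))"
  proof (rule Union_least)
    fix I assume I: "I \<in> G"
    then obtain k where "I \<in> tree_level M C k" using assms T_levels by auto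
    from stopped_le_root[OF this, of G 0] I show "I \<subseteq> (\<Union>n. stopped G n (space M))" by auto
  qed
qed

text \<open>The inequality is assumed on elements of \<open>G\<close> and is otherwise summed over
  the children. Absolute continuity makes almost disjoint children almost disjoint for
  \<open>N\<close> too, so both sides are additive.\<close>

lemma weak_type_stopped:
  assumes N: "sets N = sets M" and ac: "absolutely_continuous M N"
    and G: "\<And>I. I \<in> G \<Longrightarrow> c * emeasure M I \<le> emeasure N I" and I: "I \<in> T"
  shows "c * emeasure M (stopped G n I) \<le> emeasure N (stopped G n I)"
  using I
proof (induction n arbitrary: I)
  case (Suc n)
  show ?case
  proof (cases "I \<in> G")
    case False
    have CT: "J \<in> T" if "J \<in> C I" for J using that C_T[OF Suc.prems] by auto
    have null: "emeasure M (stopped G n J \<inter> stopped G n K) = 0"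
      if "J \<in> C I" "K \<in> C I" "J \<noteq> K" for J K
    proof -
      have "emeasure M (stopped G n J \<inter> stopped G n K) \<le> emeasure M (J \<inter> K)"
        using that CT stopped_subset T_sets by (intro emeasure_mono) (blast, auto)
      then show ?thesis using C_disjoint[OF Suc.prems that] by simp
    qed
    have nullN: "emeasure N (stopped G n J \<inter> stopped G n K) = 0"
      if "J \<in> C I" "K \<in> C I" "J \<noteq> K" for J K
    proof -
      have "stopped G n J \<inter> stopped G n K \<in> null_sets M"
        using null[OF that] that CT stopped_sets by (intro null_setsI) auto
      then show ?thesis using ac by (auto simp: absolutely_continuous_def)
    qed
    have "c * emeasure M (\<Union>J\<in>C I. stopped G n J)
        = c * (\<integral>\<^sup>+J. emeasure M (stopped G n J) \<partial>count_space (C I))"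
      using null by (subst emeasure_UN_almost_disjoint) (auto intro!: C_countable Suc.prems stopped_sets CT)
    also have "\<dots> = (\<integral>\<^sup>+J. c * emeasure M (stopped G n J) \<partial>count_space (C I))"
      by (rule nn_integral_cmult[symmetric]) simp
    also have "\<dots> \<le> (\<integral>\<^sup>+J. emeasure N (stopped G n J) \<partial>count_space (C I))"
      by (intro nn_integral_mono Suc.IH CT) simp
    also have "\<dots> = emeasure N (\<Union>J\<in>C I. stopped G n J)"
      using nullN N by (subst emeasure_UN_almost_disjoint) (auto intro!: C_countable Suc.prems stopped_sets CT)
    finally show ?thesis using False by simp
  qed (simp add: G)
qed (simp add: G)

text \<open>The level set is the union of the tree elements whose average exceeds \<open>l\<close>.
  It is exhausted by the increasing stopped sets, so the bound follows from
  \<open>weak_type_stopped\<close> by continuity from below.\<close>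

lemma maximal_op_weak_type:
  assumes [measurable]: "\<phi> \<in> borel_measurable M"
  shows "ennreal l * emeasure M {x\<in>space M. ennreal l < maximal_op M T \<phi> x}
    \<le> (\<integral>\<^sup>+x\<in>{x\<in>space M. ennreal l < maximal_op M T \<phi> x}. ennreal \<bar>\<phi> x\<bar> \<partial>M)"
proof -
  define N where "N = density M (\<lambda>x. ennreal \<bar>\<phi> x\<bar>)"
  define G where "G = {I\<in>T. ennreal l < emeasure N I / emeasure M I}"
  have N: "sets N = sets M" by (simp add: N_def)
  have Nem: "emeasure N A = (\<integral>\<^sup>+x\<in>A. ennreal \<bar>\<phi> x\<bar> \<partial>M)" if "A \<in> sets M" for A
    using that by (simp add: N_def emeasure_density)
  have ac: "absolutely_continuous M N"
    unfolding N_def by (rule absolutely_continuousI_density) simp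
  have G_T: "G \<subseteq> T" by (auto simp: G_def)
  have set_eq: "{x\<in>space M. ennreal l < maximal_op M T \<phi> x} = \<Union>G"
    using T_sets sets.sets_into_space
    by (auto simp: maximal_op_def less_SUP_iff G_def Nem)
  have G: "ennreal l * emeasure M I \<le> emeasure N I" if "I \<in> G" for I
  proof -
    have "ennreal l * emeasure M I \<le> emeasure N I / emeasure M I * emeasure M I"
      using that by (intro mult_right_mono) (auto simp: G_def)
    also have "\<dots> = emeasure N I"
    proof -
      have "emeasure M I \<noteq> 0" using T_pos[of I] that G_T by auto
      then show ?thesis by (simp add: ennreal_divide_times less_top[symmetric])
    qed
    finally show ?thesis .
  qed
  have inc: "incseq (\<lambda>n. stopped G n (space M))"
    using stopped_Suc[OF space_T] by (intro incseq_SucI)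
  have "ennreal l * emeasure M (\<Union>G) = ennreal l * (SUP n. emeasure M (stopped G n (space M)))"
    using inc stopped_sets[OF space_T] by (subst SUP_emeasure_incseq) (auto simp: Union_stopped[OF G_T])
  also have "\<dots> = (SUP n. ennreal l * emeasure M (stopped G n (space M)))"
    by (rule SUP_mult_left_ennreal)
  also have "\<dots> \<le> (SUP n. emeasure N (stopped G n (space M)))"
    by (intro SUP_mono) (use weak_type_stopped[OF N ac G space_T] in auto)
  also have "\<dots> = emeasure N (\<Union>G)"
    using inc stopped_sets[OF space_T] N by (subst SUP_emeasure_incseq) (auto simp: Union_stopped[OF G_T])
  also have "\<dots> = (\<integral>\<^sup>+x\<in>\<Union>G. ennreal \<bar>\<phi> x\<bar> \<partial>M)"
    using G_T T_sets countable_T by (intro Nem sets.countable_Union) (auto intro: countable_subset)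
  finally show ?thesis by (simp add: set_eq)
qed

text \<open>Truncation makes the \<open>p\<close>-th moment \<open>B\<close> finite, so the term
  \<open>B / a\<close> produced by Young's inequality can be absorbed on the left.\<close>

lemma nn_integral_maximal_op_le:
  assumes p: "1 < p" and \<phi>[measurable]: "\<phi> \<in> borel_measurable M"
    and nonneg: "\<And>x. x \<in> space M \<Longrightarrow> 0 \<le> \<phi> x"
    and int: "integrable M \<phi>" and intp: "integrable M (\<lambda>x. \<phi> x powr p)"
    and f: "f = (\<integral>x. \<phi> x \<partial>M)" "0 < f" and F: "F = (\<integral>x. \<phi> x powr p \<partial>M)"
    and a: "1 < a" and H: "f powr p = F * H_fun p a"
  shows "(\<integral>\<^sup>+x. ennreal_powr (maximal_op M T \<phi> x) p \<partial>M) \<le> ennreal (a powr p * F)"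
proof -
  define m where "m N x = enn2real (min (maximal_op M T \<phi> x) (ennreal N))" for N x
  have [measurable]: "m N \<in> borel_measurable M" for N unfolding m_def by measurable
  \<comment> \<open>The whole space is a tree element with average \<open>f\<close>, so only levels
    above \<open>f\<close> have to be estimated.\<close>
  have root: "ennreal f \<le> maximal_op M T \<phi> x" if "x \<in> space M" for x
  proof -
    have "ennreal f = (\<integral>\<^sup>+y. ennreal (\<phi> y) \<partial>M)"
      unfolding f by (rule nn_integral_eq_integral[symmetric]) (use int nonneg in auto)
    also have "\<dots> = (\<integral>\<^sup>+y\<in>space M. ennreal \<bar>\<phi> y\<bar> \<partial>M) / emeasure M (space M)"
      using nonneg by (auto simp: emeasure_space_1 divide_ennreal_def intro!: nn_integral_cong)
    also have "\<dots> \<le> maximal_op M T \<phi> x"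
      unfolding maximal_op_def using that space_T by (intro SUP_upper) auto
    finally show ?thesis .
  qed
  have main: "(\<integral>\<^sup>+x. ennreal (m N x powr p) \<partial>M) \<le> ennreal (a powr p * F)" if N: "f \<le> N" for N
  proof -
    have m_enn: "ennreal (m N x) = min (maximal_op M T \<phi> x) (ennreal N)" for x
      unfolding m_def by (subst ennreal_enn2real) (auto simp: min_less_iff_disj)
    have m_le: "m N x \<le> N" for x
      using m_enn[of x] N f by (subst ennreal_le_iff[symmetric]) auto
    have m_nn: "0 \<le> m N x" for x by (simp add: m_def)
    have m_ge: "f \<le> m N x" if "x \<in> space M" for x
      using root[OF that] N m_enn[of x] m_nn[of x] f by (subst ennreal_le_iff[symmetric]) (auto intro: ennreal_leI)
    \<comment> \<open>Truncation either keeps a level set or empties it, so the weak type inequality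
      carries over to \<open>m N\<close>.\<close>
    have m_less: "{x \<in> space M. l < m N x} = (if l < N then {x\<in>space M. ennreal l < maximal_op M T \<phi> x} else {})"
      if "f \<le> l" for l
    proof -
      have "l < m N x \<longleftrightarrow> l < N \<and> ennreal l < maximal_op M T \<phi> x" for x
        using f that N by (subst ennreal_less_iff[symmetric]) (auto simp: m_enn ennreal_less_iff)
      then show ?thesis by auto
    qed
    have bounded: "integrable M (\<lambda>x. m N x powr s)" if "0 \<le> s" for s
      using that m_le m_nn by (intro integrable_const_bound[where B="N powr s"]) (auto intro!: powr_mono2)
    have prod: "integrable M (\<lambda>x. \<phi> x * m N x powr (p - 1))"
    proof (rule Bochner_Integration.integrable_bound[where f="\<lambda>x. N powr (p - 1) * \<phi> x"])
      show "AE x in M. norm (\<phi> x * m N x powr (p - 1)) \<le> norm (N powr (p - 1) * \<phi> x)"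
        using nonneg m_le m_nn p by (intro AE_I2)
          (auto simp: abs_mult mult.commute[of "N powr _"] intro!: mult_left_mono powr_mono2)
    qed (use int in auto)
    have layer: "(\<integral>\<^sup>+x. ennreal (m N x powr p - f powr p) \<partial>M) \<le>
        (\<integral>\<^sup>+x. ennreal (\<phi> x) * ennreal (p / (p - 1) * (m N x powr (p - 1) - f powr (p - 1))) \<partial>M)"
    proof (rule nn_integral_layer_cake_powr_le[OF sigma_finite_measure_axioms p f(2)])
      fix l assume l: "f \<le> l"
      have "(\<integral>\<^sup>+x\<in>{x\<in>space M. ennreal l < maximal_op M T \<phi> x}. ennreal \<bar>\<phi> x\<bar> \<partial>M) =
        (\<integral>\<^sup>+x\<in>{x\<in>space M. ennreal l < maximal_op M T \<phi> x}. ennreal (\<phi> x) \<partial>M)"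
        using nonneg by (intro nn_integral_cong) auto
      then show "ennreal l * emeasure M {x \<in> space M. l < m N x} \<le> (\<integral>\<^sup>+x\<in>{x \<in> space M. l < m N x}. ennreal (\<phi> x) \<partial>M)"
        using maximal_op_weak_type[of \<phi> l] by (auto simp: m_less[OF l])
    qed (use m_ge in auto)
    let ?R = "p / (p - 1) * ((\<integral>x. \<phi> x * m N x powr (p - 1) \<partial>M) - f powr p)"
    define B where "B = (\<integral>x. m N x powr p \<partial>M)"
    have "(\<integral>\<^sup>+x. ennreal (m N x powr p - f powr p) \<partial>M) = ennreal (B - f powr p)"
      using bounded[of p] p f m_ge unfolding B_def
      by (subst nn_integral_eq_integral) (auto intro!: powr_mono2 simp: prob_space)
    \<comment> \<open>Since \<open>ennreal\<close> sends negative numbers to 0, the comparison of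
      real numbers below also needs \<open>0 \<le> ?R\<close>.\<close>
    moreover have "(\<integral>\<^sup>+x. ennreal (\<phi> x) * ennreal (p / (p - 1) * (m N x powr (p - 1) - f powr (p - 1))) \<partial>M)
       = ennreal ?R"
       and R: "0 \<le> ?R"
    proof -
      have nn: "0 \<le> p / (p - 1) * (\<phi> x * m N x powr (p - 1) - \<phi> x * f powr (p - 1))" if "x \<in> space M" for x
      proof -
        have "\<phi> x * f powr (p - 1) \<le> \<phi> x * m N x powr (p - 1)"
          using nonneg[OF that] m_ge[OF that] p f(2) by (intro mult_left_mono powr_mono2) auto
        then show ?thesis using p by simp
      qed
      have I: "integrable M (\<lambda>x. p / (p - 1) * (\<phi> x * m N x powr (p - 1) - \<phi> x * f powr (p - 1)))"
        using prod int by auto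
      have "(\<integral>\<^sup>+x. ennreal (\<phi> x) * ennreal (p / (p - 1) * (m N x powr (p - 1) - f powr (p - 1))) \<partial>M)
        = (\<integral>\<^sup>+x. ennreal (p / (p - 1) * (\<phi> x * m N x powr (p - 1) - \<phi> x * f powr (p - 1))) \<partial>M)"
        using nonneg by (intro nn_integral_cong) (simp add: ennreal_mult'[symmetric] algebra_simps)
      also have "\<dots> = ennreal (\<integral>x. p / (p - 1) * (\<phi> x * m N x powr (p - 1) - \<phi> x * f powr (p - 1)) \<partial>M)"
        by (rule nn_integral_eq_integral[OF I]) (use nn in auto)
      also have eq: "(\<integral>x. p / (p - 1) * (\<phi> x * m N x powr (p - 1) - \<phi> x * f powr (p - 1)) \<partial>M) = ?R"
        using prod int f powr_mult_base[of f "p - 1"] by (simp add: mult_ac)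
      finally show "(\<integral>\<^sup>+x. ennreal (\<phi> x) * ennreal (p / (p - 1) * (m N x powr (p - 1) - f powr (p - 1))) \<partial>M)
       = ennreal ?R" .
      show "0 \<le> ?R" unfolding eq[symmetric] by (intro integral_nonneg_AE AE_I2 nn)
    qed
    ultimately have 1: "B - f powr p \<le> ?R"
      using layer by simp
    have "p / (p - 1) * (\<integral>x. \<phi> x * m N x powr (p - 1) \<partial>M) = (\<integral>x. p / (p - 1) * (\<phi> x * m N x powr (p - 1)) \<partial>M)"
      by simp
    also have "\<dots> \<le> (\<integral>x. a powr (p - 1) / (p - 1) * \<phi> x powr p + m N x powr p / a \<partial>M)"
      using prod intp bounded[of p] p a nonneg m_nn
      by (intro integral_mono powr_Young) auto
    also have "\<dots> = a powr (p - 1) / (p - 1) * F + B / a"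
      using intp bounded[of p] p by (simp add: F B_def)
    finally have 2: "B - f powr p \<le> a powr (p - 1) / (p - 1) * F + B / a - p / (p - 1) * f powr p"
      using 1 by (simp add: right_diff_distrib)
    have aa: "a powr p = a * a powr (p - 1)" using a powr_mult_base[of a "p - 1"] by simp
    define y where "y = a powr (p - 1)"
    \<comment> \<open>Replacing \<open>f powr p\<close> by \<open>F * H_fun p a\<close> makes the
      right-hand side a multiple of \<open>1 - 1 / a\<close>, which is positive and cancels.\<close>
    have "p / (p - 1) * f powr p - f powr p = f powr p / (p - 1)" using p by (simp add: field_simps)
    with 2 have "B - B / a \<le> y / (p - 1) * F - F * (- (p - 1) * (a * y) + p * y) / (p - 1)"
      using H by (simp add: H_fun_def aa y_def)
    also have "\<dots> = (a * y * F) * (1 - 1 / a)"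
    proof -
      define d where "d = p - 1"
      have d: "0 < d" "p = d + 1" using p by (auto simp: d_def)
      have "(- d * (a * y) + (d + 1) * y) / d = y + y / d - a * y"
        using d(1) by (simp add: field_simps)
      then have "y / d * F - F * ((- d * (a * y) + (d + 1) * y) / d) = a * y * F - y * F"
        by (simp only:) (simp add: algebra_simps)
      moreover have "(a * y * F) * (1 - 1 / a) = a * y * F - y * F"
        using a by (simp add: algebra_simps)
      ultimately show ?thesis by (simp add: d)
    qed
    finally have "B * (1 - 1 / a) \<le> (a powr p * F) * (1 - 1 / a)" by (simp add: aa y_def algebra_simps)
    then have "B \<le> a powr p * F" using a by (simp add: mult_le_cancel_right)
    then show ?thesis
      using bounded[of p] p unfolding B_def by (subst nn_integral_eq_integral) (auto intro: ennreal_leI)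
  qed
  have "(\<integral>\<^sup>+x. ennreal_powr (maximal_op M T \<phi> x) p \<partial>M) = (\<integral>\<^sup>+x. (SUP n. ennreal (m (f + real n) x powr p)) \<partial>M)"
    unfolding m_def using p f by (subst ennreal_powr_eq_SUP_truncation[of p f]) auto
  also have "\<dots> = (SUP n. \<integral>\<^sup>+x. ennreal (m (f + real n) x powr p) \<partial>M)"
  proof (rule nn_integral_monotone_convergence_SUP)
    show "incseq (\<lambda>n x. ennreal (m (f + real n) x powr p))"
      unfolding m_def using p f
      by (intro incseq_SucI le_funI ennreal_leI powr_mono2 enn2real_mono min.mono)
         (auto simp: ennreal_leI min_less_iff_disj)
  qed measurable
  also have "\<dots> \<le> ennreal (a powr p * F)"
    by (intro SUP_least main) simp
  finally show ?thesis .
qed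

subsection \<open>Subfamilies of prescribed measure\<close>

text \<open>
  One step of the greedy selection: collect children of \<open>J\<close> until the next one, \<open>K\<close>, would exceed the
  mass \<open>r\<close>; the remaining mass is then less than that of \<open>K\<close>, so the selection continues inside \<open>K\<close>.
\<close>

lemma split_children:
  assumes J: "J \<in> T" and r: "0 \<le> r" "r < measure M J"
  obtains G K where "G \<subseteq> C J" "K \<in> C J" "K \<notin> G" "measure M (\<Union>G) \<le> r" "r < measure M (\<Union>G) + measure M K"
proof -
  define e where "e = to_nat_on (C J)"
  have inj: "inj_on e (C J)" unfolding e_def by (intro inj_on_to_nat_on C_countable J)
  define G where "G n = {K\<in>C J. e K < n}" for n
  have G_T: "G n \<subseteq> T" for n using C_T[OF J] by (auto simp: G_def)
  have G_sets: "\<Union>(G n) \<in> sets M" for n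
    using C_countable[OF J] G_T[of n] T_sets
    by (intro sets.countable_Union) (auto simp: G_def intro: countable_subset)
  have inc: "incseq (\<lambda>n. \<Union>(G n))"
    by (intro incseq_SucI) (auto simp: G_def intro: less_SucI)
  have "(\<Union>n. \<Union>(G n)) = \<Union>(C J)" by (auto simp: G_def)
  then have "(\<Union>n. \<Union>(G n)) = J" using C_Union[OF J] by simp
  then have "(\<lambda>n. measure M (\<Union>(G n))) \<longlonglongrightarrow> measure M J"
    using finite_Lim_measure_incseq[OF _ inc] G_sets by (metis image_subsetI)
  then have "eventually (\<lambda>n. r < measure M (\<Union>(G n))) sequentially"
    using r(2) by (rule order_tendstoD)
  then have ex: "\<exists>n. r < measure M (\<Union>(G n))" by (auto simp: eventually_sequentially)
  define n where "n = (LEAST n. r < measure M (\<Union>(G n)))"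
  have n: "r < measure M (\<Union>(G n))" unfolding n_def using ex by (rule LeastI_ex)
  have "n \<noteq> 0" using n r(1) by (intro notI) (simp add: G_def)
  then obtain j where j: "n = Suc j" by (cases n) auto
  have le: "measure M (\<Union>(G j)) \<le> r"
    using not_less_Least[of j "\<lambda>n. r < measure M (\<Union>(G n))"] j unfolding n_def[symmetric] by simp
  have "G (Suc j) \<noteq> G j" using n le j by auto
  then obtain K where K: "K \<in> C J" "e K = j"
    unfolding G_def by (auto simp: less_Suc_eq)
  have "G (Suc j) = insert K (G j)"
    using K inj by (auto simp: G_def less_Suc_eq inj_on_def)
  then have "measure M (\<Union>(G n)) \<le> measure M (K \<union> \<Union>(G j))" by (simp add: j)
  also have "\<dots> \<le> measure M K + measure M (\<Union>(G j))"
    using K C_T[OF J] T_sets G_sets by (intro measure_Un_le) auto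
  finally show ?thesis using that[of "G j" K] K le n by (auto simp: G_def)
qed

lemma level_measure_tendsto_0:
  assumes "\<And>n. J n \<in> tree_level M C (l + n)"
  shows "(\<lambda>n. measure M (J n)) \<longlonglongrightarrow> 0"
proof -
  have lim: "(\<lambda>n. SUP I\<in>tree_level M C (l + n). emeasure M I) \<longlonglongrightarrow> 0"
    using LIMSEQ_ignore_initial_segment[OF level_small, of l] by (simp add: add.commute)
  have "(\<lambda>n. emeasure M (J n)) \<longlonglongrightarrow> 0"
    by (rule tendsto_sandwich[OF _ _ tendsto_const lim])
       (use assms in \<open>auto intro!: always_eventually SUP_upper\<close>)
  then show ?thesis
    by (simp add: emeasure_eq_measure tendsto_ennreal_iff[of _ _ 0, simplified])
qed

text \<open>Iterates the greedy step. After \<open>n\<close> steps the missing mass is smaller than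
  the measure of an element of level \<open>l + n\<close>, hence tends to 0. Later selections lie
  inside a child that was not selected, which gives almost disjointness across steps.\<close>

lemma exists_subfamily:
  assumes I: "I \<in> T" and b: "0 \<le> b" "b < 1"
  obtains S where "S \<subseteq> T" "\<And>J. J \<in> S \<Longrightarrow> J \<subseteq> I"
    "\<And>J K. J \<in> S \<Longrightarrow> K \<in> S \<Longrightarrow> J \<noteq> K \<Longrightarrow> emeasure M (J \<inter> K) = 0"
    "emeasure M (\<Union>S) = ennreal b * emeasure M I"
proof -
  obtain l where l: "I \<in> tree_level M C l" using I T_levels by auto
  \<comment> \<open>A state consists of the current element, the mass still missing inside it, and
    the children selected in the step leading to it.\<close>
  define P where "P n s \<longleftrightarrow> (case s of (J, r, G) \<Rightarrow> J \<in> tree_level M C (l + n) \<and> 0 \<le> r \<and> r < measure M J)"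
    for n :: nat and s :: "'a set \<times> real \<times> 'a set set"
  define Q where "Q n s s' \<longleftrightarrow> (case s of (J, r, G) \<Rightarrow> case s' of (J', r', G') \<Rightarrow>
      G' \<subseteq> C J \<and> J' \<in> C J \<and> J' \<notin> G' \<and> r' = r - measure M (\<Union>G'))"
    for n :: nat and s s' :: "'a set \<times> real \<times> 'a set set"
  have pos: "0 < measure M I" using T_pos[OF I] by (simp add: emeasure_eq_measure)
  have "\<exists>s. (\<forall>n. P n (s n)) \<and> (\<forall>n. Q n (s n) (s (Suc n))) \<and> s 0 = (I, b * measure M I, {})"
  proof -
    have "\<exists>s'. P (Suc n) s' \<and> Q n s s'" if "P n s" for n s
    proof -
      obtain J r G where s: "s = (J, r, G)" by (cases s)
      have J: "J \<in> tree_level M C (l + n)" "0 \<le> r" "r < measure M J" using that by (auto simp: P_def s)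
      obtain G' K where GK: "G' \<subseteq> C J" "K \<in> C J" "K \<notin> G'" "measure M (\<Union>G') \<le> r"
          "r < measure M (\<Union>G') + measure M K"
        using split_children[OF level_T[OF J(1)] J(2,3)] by blast
      then show ?thesis using J
        by (intro exI[of _ "(K, r - measure M (\<Union>G'), G')"]) (auto simp: P_def Q_def s)
    qed
    moreover have "P 0 (I, b * measure M I, {})"
      using l b pos by (simp add: P_def)
    ultimately obtain s where "s 0 = (I, b * measure M I, {})" "\<And>n. P n (s n)" "\<And>n. Q n (s n) (s (Suc n))"
      using dependent_nat_choice[of "\<lambda>n s. P n s \<and> (n = 0 \<longrightarrow> s = (I, b * measure M I, {}))" Q] by (metis nat.simps(3))
    then show ?thesis by blast
  qed
  then obtain s where s: "\<And>n. P n (s n)" "\<And>n. Q n (s n) (s (Suc n))" "s 0 = (I, b * measure M I, {})"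
    by blast
  \<comment> \<open>The shift in \<open>G\<close> is deliberate: the children selected from
    \<open>J n\<close> are recorded in the state \<open>s (Suc n)\<close>.\<close>
  define J r G where "J n = fst (s n)" and "r n = fst (snd (s n))" and "G n = snd (snd (s (Suc n)))" for n
  have J: "J n \<in> tree_level M C (l + n)" and r: "0 \<le> r n" "r n < measure M (J n)" for n
    using s(1)[of n] by (auto simp: P_def J_def r_def split: prod.splits)
  have G: "G n \<subseteq> C (J n)" and J_Suc: "J (Suc n) \<in> C (J n)" "J (Suc n) \<notin> G n"
    and r_Suc: "r (Suc n) = r n - measure M (\<Union>(G n))" for n
    using s(2)[of n] by (auto simp: Q_def J_def r_def G_def split: prod.splits)
  have J0: "J 0 = I" and r0: "r 0 = b * measure M I" by (simp_all add: J_def r_def s(3))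
  have J_T: "J n \<in> T" for n using J level_T by blast
  have G_T: "G n \<subseteq> T" for n using G C_T J_T by blast
  have dec: "J n \<subseteq> J m" if "m \<le> n" for m n
    using that by (induction rule: dec_induct) (use C_subset[OF J_T J_Suc(1)] in auto)
  have G_sub: "K \<subseteq> J n" if "K \<in> G n" for K n using that G C_subset[OF J_T] by blast
  define S where "S = (\<Union>n. G n)"
  have S_T: "S \<subseteq> T" using G_T by (auto simp: S_def)
  have S_I: "K \<subseteq> I" if "K \<in> S" for K
    using that G_sub dec[of 0] J0 by (auto simp: S_def) blast
  have null_mono: "emeasure M (K \<inter> A) = 0" if "emeasure M (K \<inter> B) = 0" "A \<subseteq> B" "K \<in> T" "B \<in> sets M" for K A B
    using emeasure_mono[of "K \<inter> A" "K \<inter> B" M] that T_sets by auto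
  have next_null: "emeasure M (K \<inter> J (Suc n)) = 0" if "K \<in> G n" for K n
    using that G[of n] J_Suc[of n] by (intro C_disjoint[OF J_T[of n]]) auto
  have lt: "emeasure M (K \<inter> L) = 0" if "K \<in> G m" "L \<in> G n" "m < n" for K L m n
  proof (rule null_mono[OF next_null[OF that(1)]])
    show "L \<subseteq> J (Suc m)" using G_sub[OF that(2)] dec[of "Suc m" n] that(3) by auto
    show "K \<in> T" using that(1) G_T by blast
    show "J (Suc m) \<in> sets M" using J_T T_sets by blast
  qed
  have S_null: "emeasure M (K \<inter> L) = 0" if KL: "K \<in> S" "L \<in> S" "K \<noteq> L" for K L
  proof -
    obtain m n where mn: "K \<in> G m" "L \<in> G n" using KL by (auto simp: S_def)
    consider "m < n" | "n < m" | "m = n" by linarith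
    then show ?thesis
    proof cases
      case 1 then show ?thesis using lt mn by blast
    next
      case 2 then show ?thesis using lt[OF mn(2,1)] by (simp add: Int_commute)
    next
      case 3 then show ?thesis using mn G[of m] KL(3) by (intro C_disjoint[OF J_T[of m]]) auto
    qed
  qed
  define U where "U n = (\<Union>k<n. \<Union>(G k))" for n
  have UG_sets: "\<Union>(G k) \<in> sets M" for k
    using G_T[of k] T_sets countable_T by (intro sets.countable_Union) (auto intro: countable_subset)
  have U_sets: "U n \<in> sets M" for n unfolding U_def using UG_sets by auto
  \<comment> \<open>Everything selected before step \<open>n\<close> is almost disjoint from
    \<open>J n\<close>, so the next selection adds its full measure and the masses
    telescope.\<close>
  have U_null: "emeasure M (U n \<inter> J n) = 0" for n
  proof -
    have "U n \<inter> J n = (\<Union>K\<in>(\<Union>k<n. G k). K \<inter> J n)" by (auto simp: U_def)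
    also have "\<dots> \<in> null_sets M"
    proof (rule null_sets_UN')
      show "countable (\<Union>k<n. G k)" using G_T countable_T by (meson UN_least countable_subset)
      fix K assume "K \<in> (\<Union>k<n. G k)"
      then obtain k where k: "k < n" "K \<in> G k" by auto
      then have "emeasure M (K \<inter> J n) = 0"
        using dec[of "Suc k" n] G_T T_sets J_T by (intro null_mono[OF next_null[of K k]]) (auto simp: subset_eq)
      then show "K \<inter> J n \<in> null_sets M"
        using k G_T T_sets J_T by (intro null_setsI) (auto simp: subset_eq)
    qed
    finally show ?thesis by auto
  qed
  have U_measure: "measure M (U n) = b * measure M I - r n" for n
  proof (induction n)
    case (Suc n)
    have "\<Union>(G n) \<subseteq> J n" using G_sub by blast
    then have "emeasure M (U n \<inter> \<Union>(G n)) \<le> emeasure M (U n \<inter> J n)"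
      using U_sets J_T T_sets by (intro emeasure_mono) auto
    then have "measure M (U n \<inter> \<Union>(G n)) = 0" using U_null[of n]
      by (simp add: emeasure_eq_measure measure_le_0_iff)
    then have "measure M (U n \<union> \<Union>(G n)) = measure M (U n) + measure M (\<Union>(G n))"
      using finite_measure_Union'[OF U_sets UG_sets, of n n] finite_measure_Diff'[OF UG_sets U_sets, of n n]
      by (simp add: Int_commute)
    moreover have "U (Suc n) = U n \<union> \<Union>(G n)" by (simp add: U_def lessThan_Suc Un_commute)
    ultimately show ?case using Suc r_Suc[of n] by simp
  qed (simp add: U_def r0)
  have "r \<longlonglongrightarrow> 0"
    by (rule tendsto_sandwich[OF _ _ tendsto_const level_measure_tendsto_0[OF J]])
       (auto intro!: always_eventually r(1) less_imp_le[OF r(2)])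
  then have "(\<lambda>n. measure M (U n)) \<longlonglongrightarrow> b * measure M I - 0"
    unfolding U_measure by (intro tendsto_diff tendsto_const)
  moreover have "(\<lambda>n. measure M (U n)) \<longlonglongrightarrow> measure M (\<Union>n. U n)"
    using U_sets by (intro finite_Lim_measure_incseq incseq_SucI) (auto simp: U_def lessThan_Suc)
  moreover have "(\<Union>n. U n) = \<Union>S" by (auto simp: U_def S_def)
  ultimately have "measure M (\<Union>S) = b * measure M I" using LIMSEQ_unique by fastforce
  then have "emeasure M (\<Union>S) = ennreal b * emeasure M I"
    using b by (simp add: emeasure_eq_measure ennreal_mult)
  then show ?thesis using that[of S] S_T S_I S_null by blast
qed

section \<open>Nested cores of geometrically decreasing measure\<close>

primrec core :: "('a set \<Rightarrow> 'a set set) \<Rightarrow> nat \<Rightarrow> 'a set \<Rightarrow> 'a set" where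
  "core S 0 I = I"
| "core S (Suc k) I = (\<Union>J\<in>S I. core S k J)"

text \<open>Iterating a selection of fraction \<open>b\<close> multiplies the measure by
  \<open>b\<close> in each generation. The last property is a self-similarity: a point of the
  \<open>m\<close>-th core lies in a tree element whose own cores sit inside the later cores of
  \<open>I\<close>. Averages over that element bound the maximal function from below.\<close>

lemma exists_cores:
  assumes b: "0 \<le> b" "b < 1"
  obtains D :: "nat \<Rightarrow> 'a set \<Rightarrow> 'a set" where
    "\<And>I. D 0 I = I"
    "\<And>k I. I \<in> T \<Longrightarrow> D k I \<in> sets M"
    "\<And>k I. I \<in> T \<Longrightarrow> D (Suc k) I \<subseteq> D k I"
    "\<And>k I. I \<in> T \<Longrightarrow> emeasure M (D k I) = ennreal (b ^ k) * emeasure M I"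
    "\<And>m I x. I \<in> T \<Longrightarrow> x \<in> D m I \<Longrightarrow> \<exists>J\<in>T. x \<in> J \<and> (\<forall>k. D k J \<subseteq> D (m + k) I)"
proof -
  have "\<forall>I\<in>T. \<exists>S. S \<subseteq> T \<and> (\<forall>J\<in>S. J \<subseteq> I) \<and> (\<forall>J\<in>S. \<forall>K\<in>S. J \<noteq> K \<longrightarrow> emeasure M (J \<inter> K) = 0) \<and>
      emeasure M (\<Union>S) = ennreal b * emeasure M I"
  proof
    fix I assume "I \<in> T"
    then show "\<exists>S. S \<subseteq> T \<and> (\<forall>J\<in>S. J \<subseteq> I) \<and> (\<forall>J\<in>S. \<forall>K\<in>S. J \<noteq> K \<longrightarrow> emeasure M (J \<inter> K) = 0) \<and>
      emeasure M (\<Union>S) = ennreal b * emeasure M I"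
      by (rule exists_subfamily[OF _ b]) (rule exI conjI ballI impI | assumption)+
  qed
  from bchoice[OF this] obtain S where S0: "\<forall>I\<in>T. S I \<subseteq> T \<and> (\<forall>J\<in>S I. J \<subseteq> I) \<and>
      (\<forall>J\<in>S I. \<forall>K\<in>S I. J \<noteq> K \<longrightarrow> emeasure M (J \<inter> K) = 0) \<and>
      emeasure M (\<Union>(S I)) = ennreal b * emeasure M I" ..
  have S: "\<And>I. I \<in> T \<Longrightarrow> S I \<subseteq> T" "\<And>I J. I \<in> T \<Longrightarrow> J \<in> S I \<Longrightarrow> J \<subseteq> I"
    "\<And>I J K. I \<in> T \<Longrightarrow> J \<in> S I \<Longrightarrow> K \<in> S I \<Longrightarrow> J \<noteq> K \<Longrightarrow> emeasure M (J \<inter> K) = 0"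
    "\<And>I. I \<in> T \<Longrightarrow> emeasure M (\<Union>(S I)) = ennreal b * emeasure M I"
    using S0 by simp_all
  have S_countable: "countable (S I)" if "I \<in> T" for I
    using S(1)[OF that] countable_T by (rule countable_subset)
  have core_sets: "core S k I \<in> sets M" if "I \<in> T" for k I
    using that
  proof (induction k arbitrary: I)
    case (Suc k)
    then show ?case using S(1)[OF Suc.prems] S_countable[OF Suc.prems]
      by (auto intro!: sets.countable_UN'')
  qed (simp add: T_sets)
  have core_Suc: "core S (Suc k) I \<subseteq> core S k I" if "I \<in> T" for k I
    using that
  proof (induction k arbitrary: I)
    case 0 then show ?case using S(2) by auto
  next
    case (Suc k)
    have "core S (Suc k) J \<subseteq> core S k J" if "J \<in> S I" for J
      using that S(1)[OF Suc.prems] Suc.IH by blast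
    then show ?case unfolding core.simps(2)[of S "Suc k" I] core.simps(2)[of S k I]
      by (auto simp del: core.simps)
  qed
  have core_sub: "core S k I \<subseteq> I" if "I \<in> T" for k I
    using core_Suc[OF that] by (induction k) (auto simp del: core.simps(2))
  have core_measure: "emeasure M (core S k I) = ennreal (b ^ k) * emeasure M I" if "I \<in> T" for k I
    using that
  proof (induction k arbitrary: I)
    case (Suc k)
    have ST: "J \<in> T" if "J \<in> S I" for J using that S(1)[OF Suc.prems] by auto
    have "emeasure M (core S k J \<inter> core S k K) = 0" if "J \<in> S I" "K \<in> S I" "J \<noteq> K" for J K
    proof -
      have "emeasure M (core S k J \<inter> core S k K) \<le> emeasure M (J \<inter> K)"
        using ST that core_sub T_sets by (intro emeasure_mono) (blast, auto)
      then show ?thesis using S(3)[OF Suc.prems that] by simp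
    qed
    then have "emeasure M (core S (Suc k) I) = (\<integral>\<^sup>+J. emeasure M (core S k J) \<partial>count_space (S I))"
      unfolding core.simps
      by (intro emeasure_UN_almost_disjoint S_countable Suc.prems core_sets ST)
    also have "\<dots> = (\<integral>\<^sup>+J. ennreal (b ^ k) * emeasure M J \<partial>count_space (S I))"
      by (intro nn_integral_cong Suc.IH ST) simp
    also have "\<dots> = ennreal (b ^ k) * (\<integral>\<^sup>+J. emeasure M J \<partial>count_space (S I))"
      by (rule nn_integral_cmult) simp
    also have "(\<integral>\<^sup>+J. emeasure M J \<partial>count_space (S I)) = emeasure M (\<Union>J\<in>S I. J)"
      by (intro emeasure_UN_almost_disjoint[symmetric] S_countable Suc.prems S(3)[OF Suc.prems] T_sets ST)
    also have "\<dots> = ennreal b * emeasure M I" using S(4)[OF Suc.prems] by simp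
    finally show ?case using b by (simp add: ennreal_mult mult_ac)
  qed simp
  have core_descend: "\<exists>J\<in>T. x \<in> J \<and> (\<forall>k. core S k J \<subseteq> core S (m + k) I)" if "I \<in> T" "x \<in> core S m I" for m I x
    using that
  proof (induction m arbitrary: I)
    case (Suc m)
    then obtain J where J: "J \<in> S I" "x \<in> core S m J" by auto
    with S(1)[OF Suc.prems(1)] Suc.IH[of J] obtain K where
      "K \<in> T" "x \<in> K" "\<And>k. core S k K \<subseteq> core S (m + k) J" by blast
    then show ?case using J by (intro bexI[of _ K]) auto
  qed auto
  show ?thesis
    by (rule that[of "core S"]) (use core_sets core_Suc core_measure core_descend in \<open>auto simp del: core.simps(2)\<close>)
qed

text \<open>
  \<open>U\<close> encodes the set of tree elements containing a point as a ternary expansion, so each of its fibres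
  lies in tree elements of arbitrarily small measure.
\<close>

lemma exists_atomless:
  obtains U :: "'a \<Rightarrow> real" where "U \<in> borel_measurable M"
    "\<And>x. 0 \<le> U x" "\<And>x. U x < 1" "\<And>u. measure M {x\<in>space M. U x = u} = 0"
proof -
  define e where "e = from_nat_into T"
  have eT: "range e = T" unfolding e_def using space_T countable_T by (intro range_from_nat_into) auto
  define U :: "'a \<Rightarrow> real" where "U x = (\<Sum>k. indicator {k. x \<in> e k} k * (1/3) ^ Suc k)" for x
  note sg = sums_summable[OF ternary_sums] and su = summable_ternary_indicator
  have "(\<lambda>x. \<Sum>k. indicator (e k) x * (1/3::real) ^ Suc k) \<in> borel_measurable M"
    using eT T_sets by (intro borel_measurable_suminf borel_measurable_times borel_measurable_indicator) auto
  then have meas[measurable]: "U \<in> borel_measurable M"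
    unfolding U_def by (simp add: indicator_def)
  have nonneg: "0 \<le> U x" for x unfolding U_def by (intro suminf_nonneg su) auto
  have "U x \<le> (\<Sum>k. (1/3) ^ Suc k)" for x
    unfolding U_def by (intro suminf_le su sg) (auto simp: indicator_def)
  also have "(\<Sum>k. (1/3::real) ^ Suc k) = 1/2"
    by (rule sums_unique[OF ternary_sums, symmetric])
  finally have "U x \<le> 1/2" for x .
  then have less: "U x < 1" for x by (rule le_less_trans) simp
  have same: "x \<in> I \<longleftrightarrow> y \<in> I" if U: "U x = U y" and I: "I \<in> T" for x y I
  proof -
    have "{k. x \<in> e k} = {k. y \<in> e k}" using U unfolding U_def by (rule ternary_expansion_inj)
    moreover obtain k where "I = e k" using I eT by auto
    ultimately show ?thesis by auto
  qed
  have "measure M {x\<in>space M. U x = u} = 0" for u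
  proof (cases "\<exists>x\<in>space M. U x = u")
    case True
    then obtain x where x: "x \<in> space M" "U x = u" by auto
    have "\<forall>n. \<exists>I. I \<in> tree_level M C n \<and> x \<in> I" using level_cover[OF x(1)] by blast
    then obtain J where J: "\<And>n. J n \<in> tree_level M C n" "\<And>n. x \<in> J n" by metis
    have "(\<lambda>n. measure M (J n)) \<longlonglongrightarrow> 0" using level_measure_tendsto_0[of J 0] J by simp
    moreover have "measure M {x\<in>space M. U x = u} \<le> measure M (J n)" for n
    proof (rule finite_measure_mono)
      have "J n \<in> T" using J level_T by blast
      then show "J n \<in> sets M" by (rule T_sets)
      show "{x\<in>space M. U x = u} \<subseteq> J n"
        using same[OF _ \<open>J n \<in> T\<close>] x(2) J(2)[of n] by blast
    qed
    ultimately have "measure M {x\<in>space M. U x = u} \<le> 0"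
      by (intro LIMSEQ_le_const) auto
    then show ?thesis by (simp add: measure_le_0_iff)
  next
    case False
    then have "{x\<in>space M. U x = u} = {}" by auto
    then show ?thesis by (simp only: measure_empty)
  qed
  with that[OF meas nonneg less] show ?thesis by blast
qed

end

subsection \<open>Near-extremal functions\<close>

context prob_space
begin

text \<open>Points are ordered first by the last \<open>A k\<close> containing them and then by
  \<open>U\<close>. The variable \<open>W\<close> realizes this order, and applying its cdf makes it
  uniform while preserving the order, so \<open>A k\<close> corresponds to the values up to
  \<open>prob (A k)\<close>.\<close>

lemma exists_uniform_adapted:
  fixes U :: "'a \<Rightarrow> real" and A :: "nat \<Rightarrow> 'a set"
  assumes U[measurable]: "U \<in> borel_measurable M" and U_bounds: "\<And>x. 0 \<le> U x" "\<And>x. U x < 1"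
    and atomless: "\<And>u. prob {x\<in>space M. U x = u} = 0"
    and A_sets[measurable]: "\<And>k. A k \<in> sets M" and A0: "A 0 = space M"
    and decA: "decseq A" and A_lim: "(\<lambda>k. prob (A k)) \<longlonglongrightarrow> 0"
  obtains V :: "'a \<Rightarrow> real" where "V \<in> borel_measurable M"
    "distr M borel V = uniform_measure lborel {0..1}"
    "AE x in M. (\<exists>k. x \<notin> A k) \<and> (\<forall>k. (x \<in> A k \<longrightarrow> V x \<le> prob (A k)) \<and> (x \<notin> A k \<longrightarrow> prob (A k) \<le> V x))"
proof -
  have "prob (\<Inter>k. A k) = 0"
    using finite_Lim_measure_decseq[OF _ decA] A_sets by (intro LIMSEQ_unique[OF _ A_lim]) (simp add: image_subset_iff)
  then have "(\<Inter>k. A k) \<in> null_sets M" by (intro null_setsI) (auto simp: emeasure_eq_measure)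
  then have out: "AE x in M. \<exists>k. x \<notin> A k" by (intro AE_I'[where N="\<Inter>k. A k"]) auto
  \<comment> \<open>Junk value on the null set of points that lie in every \<open>A k\<close>.\<close>
  define n where "n x = (LEAST j. x \<notin> A (Suc j))" for x
  have [measurable]: "n \<in> measurable M (count_space UNIV)"
    unfolding n_def by measurable
  have n: "k \<le> n x \<longleftrightarrow> x \<in> A k" if x: "x \<in> space M" and ex: "\<exists>k. x \<notin> A k" for x k
  proof
    assume k: "k \<le> n x"
    show "x \<in> A k"
    proof (cases k)
      case 0 then show ?thesis using x A0 by simp
    next
      case (Suc j)
      then have "j < n x" using k by simp
      then show ?thesis using not_less_Least[of j "\<lambda>j. x \<notin> A (Suc j)"] Suc by (simp add: n_def)
    qed
  next
    assume xk: "x \<in> A k"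
    obtain j where "x \<notin> A j" using ex by auto
    then have "x \<notin> A (Suc j)" using decseqD[OF decA, of j "Suc j"] by auto
    then have "x \<notin> A (Suc (n x))" unfolding n_def by (rule LeastI)
    moreover have "A k \<subseteq> A (Suc (n x))" if "\<not> k \<le> n x" using decseqD[OF decA] that by simp
    ultimately show "k \<le> n x" using xk by blast
  qed
  \<comment> \<open>As \<open>U\<close> takes values in \<open>[0,1)\<close>, the points with
    \<open>n x = j\<close> have \<open>W x\<close> in \<open>[-j, 1 - j)\<close>; hence the sets
    \<open>A k\<close> are, up to null sets, the sublevel sets
    \<open>W x < 1 - real k\<close>.\<close>
  define W where "W x = U x - real (n x)" for x
  have [measurable]: "W \<in> borel_measurable M" unfolding W_def by measurable
  interpret W: real_distribution "distr M borel W" by (rule real_distribution_distr) simp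
  have "measure (distr M borel W) {w} = 0" for w
  proof -
    \<comment> \<open>A fibre of \<open>W\<close> meets only countably many fibres of
      \<open>U\<close>, all of them null.\<close>
    have "{x\<in>space M. W x = w} \<subseteq> (\<Union>j::nat. {x\<in>space M. U x = w + real j})"
      by (auto simp: W_def)
    moreover have "(\<Union>j::nat. {x\<in>space M. U x = w + real j}) \<in> null_sets M"
      using atomless by (intro null_sets_UN null_setsI) (auto simp: emeasure_eq_measure)
    ultimately have "{x\<in>space M. W x = w} \<in> null_sets M"
      by (rule null_sets_subset[rotated 2, OF _ _]) measurable
    then show ?thesis
      by (simp add: measure_distr vimage_def Int_def conj_commute measure_eq_0_null_sets)
  qed
  note transform = W.probability_integral_transform[OF this]
  define V where "V x = cdf (distr M borel W) (W x)" for x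
  have mono: "mono (cdf (distr M borel W))" by (intro monoI W.cdf_nondecreasing)
  have cdf_meas[measurable]: "cdf (distr M borel W) \<in> borel_measurable borel"
    using mono by (rule borel_measurable_mono)
  have V[measurable]: "V \<in> borel_measurable M" unfolding V_def by measurable
  have "distr M borel V = distr (distr M borel W) borel (cdf (distr M borel W))"
    by (subst distr_distr) (auto simp: V_def[abs_def] comp_def)
  then have distr_V: "distr M borel V = uniform_measure lborel {0..1}" using transform by simp
  have cdf_eq: "V x = prob {y\<in>space M. W y \<le> W x}" for x
    by (simp add: V_def cdf_def measure_distr vimage_def Int_def conj_commute)
  have W_less: "W x < 1 - real k \<longleftrightarrow> x \<in> A k" if "x \<in> space M" "\<exists>k. x \<notin> A k" for x k
  proof -
    have "W x < 1 - real k \<longleftrightarrow> k \<le> n x"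
    proof
      assume "W x < 1 - real k"
      then have "real k < real (n x) + 1" using U_bounds(1)[of x] by (simp add: W_def)
      then show "k \<le> n x" by linarith
    next
      assume "k \<le> n x"
      then show "W x < 1 - real k" using U_bounds(2)[of x] by (simp add: W_def)
    qed
    then show ?thesis using n[OF that] by simp
  qed
  have prob_A: "prob {y\<in>space M. W y < 1 - real k} = prob (A k)" for k
  proof (rule finite_measure_eq_AE)
    show "AE y in M. y \<in> {y\<in>space M. W y < 1 - real k} \<longleftrightarrow> y \<in> A k"
      using out AE_space by eventually_elim (use W_less in auto)
  qed measurable
  have "AE x in M. (\<exists>k. x \<notin> A k) \<and> (\<forall>k. (x \<in> A k \<longrightarrow> V x \<le> prob (A k)) \<and> (x \<notin> A k \<longrightarrow> prob (A k) \<le> V x))"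
    using out AE_space
  proof eventually_elim
    case (elim x)
    have "V x \<le> prob (A k)" if "x \<in> A k" for k
    proof -
      have "W x < 1 - real k" using W_less elim that by blast
      then show ?thesis unfolding cdf_eq prob_A[symmetric] by (intro finite_measure_mono) auto
    qed
    moreover have "prob (A k) \<le> V x" if "x \<notin> A k" for k
    proof -
      have "\<not> W x < 1 - real k" using W_less elim that by blast
      then show ?thesis unfolding cdf_eq prob_A[symmetric] by (intro finite_measure_mono) auto
    qed
    ultimately show ?case using elim by blast
  qed
  with that[OF V distr_V] show ?thesis by blast
qed

lemma uniform_powr_moment:
  assumes [measurable]: "V \<in> borel_measurable M" and V: "distr M borel V = uniform_measure lborel {0..1}"
    and c: "0 \<le> c" and e: "- 1 < e * s"
  shows "(\<integral>\<^sup>+x. ennreal ((c * V x powr e) powr s) \<partial>M) = ennreal (c powr s / (e * s + 1))"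
proof -
  have "(\<integral>\<^sup>+x. ennreal ((c * V x powr e) powr s) \<partial>M) = (\<integral>\<^sup>+t. ennreal ((c * t powr e) powr s) \<partial>distr M borel V)"
    by (subst nn_integral_distr) auto
  also have "\<dots> = (\<integral>\<^sup>+t. ennreal ((c * t powr e) powr s) * indicator {0..1} t \<partial>lborel)"
    unfolding V by (subst nn_integral_uniform_measure) (auto simp: divide_ennreal_def)
  also have "\<dots> = (\<integral>\<^sup>+t. ennreal (indicator {0..1} t * (c powr s * t powr (e * s))) \<partial>lborel)"
    using c by (intro nn_integral_cong) (auto simp: indicator_def powr_mult powr_powr)
  also have "\<dots> = ennreal (c powr s * (1 powr (e * s + 1) / (e * s + 1)))"
    using has_integral_mult_right[OF has_integral_powr_from_0[OF e, of 1], of "c powr s"]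
    by (intro nn_integral_has_integral_lebesgue) auto
  finally show ?thesis by simp
qed

end

text \<open>In this form \<open>f powr s / H_fun s a\<close> is visibly the \<open>s\<close>-th
  moment of \<open>(f / a) * t powr (1 / a - 1)\<close> on \<open>(0,1]\<close>, and positivity of
  \<open>H_fun s a\<close> amounts to the integrability condition
  \<open>s * (1 - 1 / a) < 1\<close>.\<close>

lemma H_fun_eq:
  assumes "0 < a" shows "H_fun s a = a powr s * (1 - s * (1 - 1 / a))"
proof -
  have "a powr s = a * a powr (s - 1)" using assms powr_mult_base[of a "s - 1"] by simp
  then show ?thesis using assms by (simp add: H_fun_def field_simps)
qed

section \<open>Averages over tree elements and the near-extremal function\<close>

context tree_prob_space
begin

text \<open>The ring \<open>D k - D (Suc k)\<close> has measure \<open>b ^ k * (1 - b)\<close> times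
  that of \<open>J\<close>. Multiplied by the lower bound for the function there, this gives a
  geometric series with ratio \<open>b powr (1 / a)\<close>.\<close>

lemma average_lower_bound:
  fixes D :: "nat \<Rightarrow> 'a set"
  assumes [measurable]: "\<phi> \<in> borel_measurable M" "J \<in> sets M" "\<And>k. D k \<in> sets M"
    and D0: "D 0 = J" and decD: "\<And>k. D (Suc k) \<subseteq> D k"
    and measure_D: "\<And>k. emeasure M (D k) = ennreal (b ^ k) * emeasure M J"
    and b: "0 < b" "b < 1" and g: "0 \<le> g" and a: "0 < a"
    and \<phi>: "AE x in M. \<forall>k. x \<in> D k \<longrightarrow> g * (b ^ k) powr (1 / a - 1) \<le> \<phi> x"
  shows "ennreal (g * ((1 - b) / (1 - b powr (1 / a)))) * emeasure M J \<le> (\<integral>\<^sup>+x\<in>J. ennreal \<bar>\<phi> x\<bar> \<partial>M)"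
proof -
  define c where "c k = g * (b ^ k) powr (1 / a - 1)" for k
  have c: "0 \<le> c k" for k using g by (simp add: c_def)
  define E where "E k = D k - D (Suc k)" for k
  have [measurable]: "E k \<in> sets M" for k by (simp add: E_def)
  have decseq: "decseq D" using decD by (rule decseq_SucI)
  have disj: "disjoint_family E"
  proof -
    have "E i \<inter> E j = {}" if "i < j" for i j
      using decseqD[OF decseq, of "Suc i" j] that by (auto simp: E_def)
    then show ?thesis unfolding disjoint_family_on_def by (metis Int_commute nat_neq_iff)
  qed
  define \<mu> where "\<mu> = measure M J"
  have \<mu>: "measure M (D k) = b ^ k * \<mu>" for k
    using measure_D[of k] b by (simp add: emeasure_eq_measure \<mu>_def ennreal_mult[symmetric])
  have E: "emeasure M (E k) = ennreal (b ^ k * (1 - b) * \<mu>)" for k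
    unfolding emeasure_eq_measure E_def using decD
    by (subst finite_measure_Diff) (auto simp: \<mu> algebra_simps)
  define z where "z = b powr (1 / a)"
  have z: "0 < z" "z < 1" using b a powr_less_mono2[of "1/a" b 1] by (auto simp: z_def)
  have summand: "c k * (b ^ k * (1 - b) * \<mu>) = g * (1 - b) * \<mu> * z ^ k" for k
  proof -
    have "(b ^ k) powr (1 / a - 1) * b ^ k = (b ^ k) powr (1 / a)"
      using b powr_mult_base[of "b ^ k" "1 / a - 1"] by (simp add: mult.commute)
    also have "\<dots> = z ^ k"
      using b by (simp add: z_def powr_realpow[symmetric] powr_powr mult.commute)
    finally show ?thesis by (simp add: c_def mult_ac)
  qed
  have "(\<lambda>k. g * (1 - b) * \<mu> * z ^ k) sums (g * (1 - b) * \<mu> * (1 / (1 - z)))"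
    using z by (intro sums_mult geometric_sums) auto
  then have "ennreal (g * (1 - b) * \<mu> * (1 / (1 - z))) = (\<Sum>k. ennreal (c k * (b ^ k * (1 - b) * \<mu>)))"
    unfolding summand using b g z by (intro suminf_ennreal_eq[symmetric]) (auto simp: \<mu>_def)
  also have "\<dots> = (\<Sum>k. \<integral>\<^sup>+x. ennreal (c k) * indicator (E k) x \<partial>M)"
    using b c by (intro suminf_cong) (simp add: nn_integral_cmult_indicator E ennreal_mult \<mu>_def)
  also have "\<dots> = (\<integral>\<^sup>+x. (\<Sum>k. ennreal (c k) * indicator (E k) x) \<partial>M)"
    by (rule nn_integral_suminf[symmetric]) simp
  also have "\<dots> \<le> (\<integral>\<^sup>+x\<in>J. ennreal \<bar>\<phi> x\<bar> \<partial>M)"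
  proof (rule nn_integral_mono_AE)
    show "AE x in M. (\<Sum>k. ennreal (c k) * indicator (E k) x) \<le> ennreal \<bar>\<phi> x\<bar> * indicator J x"
      using \<phi>
    proof eventually_elim
      case (elim x)
      show ?case
      proof (cases "\<exists>k. x \<in> E k")
        case True
        then obtain k where k: "x \<in> E k" by auto
        then have "x \<in> D k" "x \<in> J" using decseqD[OF decseq, of 0 k] D0 by (auto simp: E_def)
        moreover have "(\<Sum>k. ennreal (c k) * indicator (E k) x) = ennreal (c k)"
          using disj k by (rule suminf_cmult_indicator)
        ultimately show ?thesis using elim by (auto simp: c_def intro!: ennreal_leI order_trans[OF _ abs_ge_self])
      qed simp
    qed
  qed
  finally show ?thesis
    using g b z ennreal_mult[of "g * ((1 - b) / (1 - z))" \<mu>]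
    by (simp add: emeasure_eq_measure \<mu>_def[symmetric] z_def[symmetric])
      (simp add: \<mu>_def mult_ac)
qed

text \<open>The moments depend only on the distribution of \<open>V\<close> and are therefore exact
  for every \<open>b\<close>; only the pointwise comparison with the maximal function loses a
  factor. That loss is \<open>b powr (1 - 1 / a)\<close>, from the variation of the profile between
  \<open>b ^ Suc m\<close> and \<open>b ^ m\<close>, together with the discretized average.\<close>

lemma exists_near_extremal:
  assumes a: "1 < a" and f: "0 < f" and b: "0 < b" "b < 1" and p: "1 < p" "p * (1 - 1 / a) < 1"
  obtains \<phi> :: "'a \<Rightarrow> real" where "\<phi> \<in> borel_measurable M" "\<And>x. 0 \<le> \<phi> x"
    "\<And>s. 0 \<le> s \<Longrightarrow> s \<le> p \<Longrightarrow> (\<integral>\<^sup>+x. ennreal (\<phi> x powr s) \<partial>M) = ennreal (f powr s / H_fun s a)"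
    "AE x in M. ennreal ((1 - b) / (1 - b powr (1 / a)) * b powr (1 - 1 / a) * \<phi> x) \<le> maximal_op M T \<phi> x"
proof -
  obtain D where D0: "\<And>I. D 0 I = I"
    and D_sets: "\<And>k I. I \<in> T \<Longrightarrow> D k I \<in> sets M"
    and D_Suc: "\<And>k I. I \<in> T \<Longrightarrow> D (Suc k) I \<subseteq> D k I"
    and D_measure: "\<And>k I. I \<in> T \<Longrightarrow> emeasure M (D k I) = ennreal (b ^ k) * emeasure M I"
    and D_descend: "\<And>m I x. I \<in> T \<Longrightarrow> x \<in> D m I \<Longrightarrow> \<exists>J\<in>T. x \<in> J \<and> (\<forall>k. D k J \<subseteq> D (m + k) I)"
    using exists_cores[of b] b by auto
  define A where "A k = D k (space M)" for k
  have A_sets: "A k \<in> sets M" and decA: "decseq A" for k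
    unfolding A_def using D_sets[OF space_T] D_Suc[OF space_T] by (auto intro!: decseq_SucI)
  have prob_A: "prob (A k) = b ^ k" for k
    using D_measure[OF space_T, of k] b by (simp add: A_def emeasure_eq_measure prob_space)
  obtain U :: "'a \<Rightarrow> real" where U: "U \<in> borel_measurable M"
    "\<And>x. 0 \<le> U x" "\<And>x. U x < 1" "\<And>u. measure M {x\<in>space M. U x = u} = 0"
    using exists_atomless by blast
  have "A 0 = space M" "(\<lambda>k. prob (A k)) \<longlonglongrightarrow> 0"
    using b by (auto simp: A_def D0 prob_A[unfolded A_def] intro: LIMSEQ_power_zero)
  from exists_uniform_adapted[OF U A_sets this(1) decA this(2)]
  obtain V where V[measurable]: "V \<in> borel_measurable M"
    and distr_V: "distr M borel V = uniform_measure lborel {0..1}"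
    and V_A: "AE x in M. (\<exists>k. x \<notin> A k) \<and> (\<forall>k. (x \<in> A k \<longrightarrow> V x \<le> b ^ k) \<and> (x \<notin> A k \<longrightarrow> b ^ k \<le> V x))"
    unfolding prob_A by blast
  have "AE t in distr M borel V. 0 < t"
    unfolding distr_V by (rule AE_uniform_measureI) (auto intro: AE_mp[OF AE_lborel_singleton[of 0]])
  \<comment> \<open>The profile is decreasing only on positive arguments, because
    \<open>0 powr _\<close> is 0.\<close>
  then have V_pos: "AE x in M. 0 < V x" by (subst (asm) AE_distr_iff) auto
  define \<phi> where "\<phi> x = f / a * V x powr (1 / a - 1)" for x
  have [measurable]: "\<phi> \<in> borel_measurable M" unfolding \<phi>_def by measurable
  have nonneg: "0 \<le> \<phi> x" for x using f a by (simp add: \<phi>_def)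
  have moment: "(\<integral>\<^sup>+x. ennreal (\<phi> x powr s) \<partial>M) = ennreal (f powr s / H_fun s a)" if s: "0 \<le> s" "s \<le> p" for s
  proof -
    have "s * (1 - 1 / a) \<le> p * (1 - 1 / a)" using s a by (intro mult_right_mono) auto
    then have "- 1 < (1 / a - 1) * s" using p by (simp add: algebra_simps)
    from uniform_powr_moment[OF V distr_V _ this, of "f / a"] f a
    have "(\<integral>\<^sup>+x. ennreal (\<phi> x powr s) \<partial>M) = ennreal ((f / a) powr s / ((1 / a - 1) * s + 1))"
      by (simp add: \<phi>_def)
    also have "(f / a) powr s / ((1 / a - 1) * s + 1) = f powr s / H_fun s a"
      using f a by (simp add: H_fun_eq powr_divide algebra_simps)
    finally show ?thesis .
  qed
  have \<phi>_mono: "f / a * u powr (1 / a - 1) \<le> f / a * v powr (1 / a - 1)" if "0 < v" "v \<le> u" for u v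
    using that f a powr_mono2'[of "1 / a - 1" v u] by (intro mult_left_mono) auto
  have \<phi>_A: "AE x in M. \<forall>k. x \<in> A k \<longrightarrow> f / a * (b ^ k) powr (1 / a - 1) \<le> \<phi> x"
    using V_A V_pos
  proof eventually_elim
    case (elim x)
    then show ?case unfolding \<phi>_def by (intro allI impI \<phi>_mono) auto
  qed
  define \<kappa> where "\<kappa> = (1 - b) / (1 - b powr (1 / a))"
  have "b powr (1 / a) < 1" using b a powr_less_mono2[of "1/a" b 1] by simp
  then have \<kappa>: "0 \<le> \<kappa>" using b by (simp add: \<kappa>_def)
  have "AE x in M. ennreal (\<kappa> * b powr (1 - 1 / a) * \<phi> x) \<le> maximal_op M T \<phi> x"
    using V_A V_pos AE_space
  proof eventually_elim
    case (elim x)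
    \<comment> \<open>The index \<open>m\<close> is the last one with \<open>x\<close> in
      \<open>A m\<close>. The element \<open>J\<close> chosen below contains \<open>x\<close> and
      has its \<open>k\<close>-th core in \<open>A (m + k)\<close>, where the function is at least
      \<open>g * (b ^ k) powr (1 / a - 1)\<close>.\<close>
    define m where "m = (LEAST k. x \<notin> A (Suc k))"
    obtain j where "x \<notin> A j" using elim by auto
    then have "x \<notin> A (Suc j)" using decseqD[OF decA, of j "Suc j"] by auto
    then have out: "x \<notin> A (Suc m)" unfolding m_def by (rule LeastI)
    have "x \<in> A m"
    proof (cases m)
      case 0 then show ?thesis using elim by (simp add: A_def D0)
    next
      case (Suc i)
      then show ?thesis using not_less_Least[of i "\<lambda>k. x \<notin> A (Suc k)"] by (simp add: m_def)
    qed
    then obtain J where J: "J \<in> T" "x \<in> J" "\<And>k. D k J \<subseteq> A (m + k)"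
      using D_descend[OF space_T, of x m] by (auto simp: A_def)
    define g where "g = f / a * (b ^ m) powr (1 / a - 1)"
    have g: "0 \<le> g" using f a by (simp add: g_def)
    have "AE x in M. \<forall>k. x \<in> D k J \<longrightarrow> g * (b ^ k) powr (1 / a - 1) \<le> \<phi> x"
      using \<phi>_A
    proof eventually_elim
      case (elim x)
      show ?case
      proof safe
        fix k assume "x \<in> D k J"
        then have "f / a * (b ^ (m + k)) powr (1 / a - 1) \<le> \<phi> x" using elim J(3) by blast
        then show "g * (b ^ k) powr (1 / a - 1) \<le> \<phi> x"
          using b by (simp add: g_def power_add powr_mult mult_ac)
      qed
    qed
    from average_lower_bound[OF _ T_sets[OF J(1)] D_sets[OF J(1)] D0 D_Suc[OF J(1)] D_measure[OF J(1)] b g _ this] a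
    have avg: "ennreal (g * \<kappa>) * emeasure M J \<le> (\<integral>\<^sup>+x\<in>J. ennreal \<bar>\<phi> x\<bar> \<partial>M)"
      by (simp add: \<kappa>_def)
    have pos: "0 < emeasure M J" using T_pos J(1) by simp
    have "ennreal (g * \<kappa>) = ennreal (g * \<kappa>) * emeasure M J / emeasure M J"
      using pos by (intro mult_divide_eq_ennreal[symmetric]) auto
    also have "\<dots> \<le> (\<integral>\<^sup>+x\<in>J. ennreal \<bar>\<phi> x\<bar> \<partial>M) / emeasure M J"
      by (intro divide_right_mono_ennreal avg)
    also have "\<dots> \<le> maximal_op M T \<phi> x"
      unfolding maximal_op_def using J by (intro SUP_upper) auto
    finally have max: "ennreal (g * \<kappa>) \<le> maximal_op M T \<phi> x" .
    \<comment> \<open>Outside \<open>A (Suc m)\<close> the variable \<open>V\<close> is at least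
      \<open>b ^ Suc m\<close>, and the profile is decreasing.\<close>
    have "\<phi> x \<le> f / a * (b ^ Suc m) powr (1 / a - 1)"
    proof -
      have "b ^ Suc m \<le> V x" using elim out by blast
      then show ?thesis unfolding \<phi>_def using b by (intro \<phi>_mono) auto
    qed
    also have "\<dots> = g * b powr (1 / a - 1)"
      using b by (simp add: g_def powr_mult mult_ac)
    finally have "b powr (1 - 1 / a) * \<phi> x \<le> b powr (1 - 1 / a) * (g * b powr (1 / a - 1))"
      by (intro mult_left_mono) auto
    also have "\<dots> = g" using b by (simp add: powr_add[symmetric] mult.left_commute)
    finally have "\<kappa> * (b powr (1 - 1 / a) * \<phi> x) \<le> \<kappa> * g" using \<kappa> by (intro mult_left_mono)
    then have "ennreal (\<kappa> * b powr (1 - 1 / a) * \<phi> x) \<le> ennreal (g * \<kappa>)"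
      by (intro ennreal_leI) (simp add: mult_ac)
    then show ?case using max by (rule order_trans)
  qed
  then show ?thesis using that[of \<phi>] nonneg moment by (simp add: \<kappa>_def)
qed

end

subsection \<open>The Bellman function\<close>

text \<open>The derivative is \<open>- (r * (r - 1) * z powr (r - 2) * (z - 1))\<close>. It vanishes
  at 1, so its sign is used only on the open interval.\<close>

lemma H_fun_strict_decreasing:
  assumes r: "1 < r" and xy: "1 \<le> x" "x < y"
  shows "H_fun r y < H_fun r x"
proof (rule DERIV_neg_imp_decreasing_open[OF xy(2)])
  fix z assume z: "x < z" "z < y"
  then have "1 < z" using xy by simp
  have z1: "z powr (r - 1) = z * z powr (r - 2)" using \<open>1 < z\<close> powr_mult_base[of z "r - 2"] by simp
  have "(H_fun r has_real_derivative (- (r - 1) * (r * z powr (r - 1)) + r * ((r - 1) * z powr (r - 2)))) (at z)"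
    unfolding H_fun_def[abs_def] using \<open>1 < z\<close> by (auto intro!: derivative_eq_intros)
  moreover have "- (r - 1) * (r * z powr (r - 1)) + r * ((r - 1) * z powr (r - 2)) = - (r * (r - 1) * z powr (r - 2) * (z - 1))"
    unfolding z1 by (simp add: algebra_simps)
  moreover have "0 < r * (r - 1) * z powr (r - 2) * (z - 1)"
    using r \<open>1 < z\<close> by simp
  ultimately show "\<exists>d. (H_fun r has_real_derivative d) (at z) \<and> d < 0"
    by (metis neg_less_0_iff_less)
next
  show "continuous_on {x..y} (H_fun r)"
    unfolding H_fun_def[abs_def] using xy by (intro continuous_intros) auto
qed

text \<open>\<open>H_fun r\<close> takes the values 1 and 0 at the ends of the interval; the
  intermediate value theorem gives surjectivity onto \<open>[0,1]\<close> and strict monotonicity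
  gives injectivity.\<close>

lemma omega_inverse:
  assumes r: "1 < r" and y: "0 \<le> y" "y \<le> 1"
  shows "omega r y \<in> {1..r / (r - 1)}" and "H_fun r (omega r y) = y"
proof -
  have inj: "inj_on (H_fun r) {1..r / (r - 1)}"
    by (rule linorder_inj_onI') (use H_fun_strict_decreasing[OF r] in \<open>force\<close>)
  have one: "1 \<le> r / (r - 1)" using r by simp
  have end0: "H_fun r (r / (r - 1)) = 0"
    using r by (subst H_fun_eq) (auto simp: field_simps)
  have "\<exists>x\<ge>1. x \<le> r / (r - 1) \<and> H_fun r x = y"
  proof (rule IVT2')
    show "continuous_on {1..r / (r - 1)} (H_fun r)"
      unfolding H_fun_def[abs_def] by (intro continuous_intros) auto
  qed (use one end0 y in \<open>auto simp: H_fun_def\<close>)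
  then have "y \<in> H_fun r ` {1..r / (r - 1)}" by auto
  then show "omega r y \<in> {1..r / (r - 1)}" "H_fun r (omega r y) = y"
    unfolding omega_def using inj by (auto intro: the_inv_into_into f_the_inv_into_f del: atLeastAtMost_iff simp del: atLeastAtMost_iff)
qed

text \<open>The quotient is the reciprocal of the difference quotient of
  \<open>b powr (1 / a)\<close> at 1, where the derivative is \<open>1 / a\<close>.\<close>

lemma extremal_ratio_tendsto:
  assumes a: "0 < a"
  shows "((\<lambda>b::real. (1 - b) / (1 - b powr (1 / a)) * b powr (1 - 1 / a)) \<longlongrightarrow> a) (at_left 1)"
proof -
  have "((\<lambda>b::real. b powr (1 / a)) has_real_derivative 1 / a) (at 1)"
    using a by (auto intro!: derivative_eq_intros)
  then have "((\<lambda>b::real. (b powr (1 / a) - 1) / (b - 1)) \<longlongrightarrow> 1 / a) (at 1)"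
    by (simp add: has_field_derivative_iff)
  from tendsto_inverse[OF this]
  have "((\<lambda>b::real. inverse ((b powr (1 / a) - 1) / (b - 1))) \<longlongrightarrow> a) (at 1)"
    using a by simp
  moreover have "((\<lambda>b::real. b powr (1 - 1 / a)) \<longlongrightarrow> 1 powr (1 - 1 / a)) (at 1)"
    by (intro tendsto_intros) auto
  ultimately have "((\<lambda>b::real. inverse ((b powr (1 / a) - 1) / (b - 1)) * b powr (1 - 1 / a)) \<longlongrightarrow> a * 1 powr (1 - 1 / a)) (at 1)"
    by (rule tendsto_mult)
  moreover have "inverse ((b powr (1 / a) - 1) / (b - 1)) = (1 - b) / (1 - b powr (1 / a))" for b :: real
    using minus_divide_divide[of "b - 1" "b powr (1 / a) - 1"] by simp
  ultimately have "((\<lambda>b::real. (1 - b) / (1 - b powr (1 / a)) * b powr (1 - 1 / a)) \<longlongrightarrow> a) (at 1)"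
    by (simp only: powr_one_eq_one mult_1_right)
  then show ?thesis by (rule filterlim_at_split[THEN iffD1, THEN conjunct1])
qed

theorem theorem1:
  fixes M :: "'a measure" and T :: "'a set set" and p q f A F :: real
  assumes "1 < q" and "q < p"
    and "prob_space M" and "non_atomic M" and "is_tree M T"
    and "f > 0" and "f powr q < A"
    and "f powr p \<le> F"
    and "omega p (f powr p / F) = omega q (f powr q / A)"
  shows "bellman M T p q f A F = ennreal (omega q (f powr q / A) powr p * F)"
proof -
  define a where "a = omega q (f powr q / A)"
  have p: "1 < p" using assms by simp
  have fq: "0 < f powr q" and fp: "0 < f powr p" using assms by auto
  then have A: "0 < A" and F: "0 < F" using assms by linarith+
  have aq: "a \<in> {1..q / (q - 1)}" "H_fun q a = f powr q / A"
    unfolding a_def by (rule omega_inverse; use assms(1,7) fq A in simp)+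
  have ap: "a \<in> {1..p / (p - 1)}" "H_fun p a = f powr p / F"
    unfolding a_def assms(9)[symmetric] by (rule omega_inverse; use p assms(8) fp F in simp)+
  \<comment> \<open>At 1 the value of \<open>H_fun q\<close> is 1, whereas
    \<open>f powr q / A < 1\<close>.\<close>
  have "a \<noteq> 1" using aq(2) assms(7) A by (auto simp: H_fun_def)
  with aq have a: "1 < a" by auto
  \<comment> \<open>All three constraints take the form of the moment formula in
    \<open>exists_near_extremal\<close>; for exponent 1 this holds because
    \<open>H_fun 1 a = 1\<close>.\<close>
  have Hq: "A = f powr q / H_fun q a" and Hp: "F = f powr p / H_fun p a" and H1: "f = f powr 1 / H_fun 1 a"
    using aq(2) ap(2) fq fp A F a assms(6) by (auto simp: H_fun_def)
  have "0 < H_fun p a" using ap(2) fp F by simp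
  then have pa: "p * (1 - 1 / a) < 1" using a by (simp add: H_fun_eq zero_less_mult_iff)
  interpret prob_space M by fact
  from assms(5)[unfolded is_tree_def] obtain C where T: "T \<subseteq> sets M" "space M \<in> T" "\<forall>I\<in>T. emeasure M I > 0"
    and C: "\<forall>I\<in>T. C I \<subseteq> T \<and> countable (C I) \<and> (\<exists>J\<in>C I. \<exists>K\<in>C I. J \<noteq> K) \<and>
       (\<forall>J\<in>C I. J \<subseteq> I) \<and> pairwise (almost_disjoint M) (C I) \<and> I = \<Union>(C I)"
    and levels: "T = (\<Union>m. tree_level M C m)" "(\<lambda>m. SUP I\<in>tree_level M C m. emeasure M I) \<longlonglongrightarrow> 0"
    by (elim conjE exE) (rule that; assumption)
  interpret tree_prob_space M T C
  proof
    fix I assume I: "I \<in> T"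
    show "I \<in> sets M" "emeasure M I > 0" using T I by auto
    show "C I \<subseteq> T" "countable (C I)" "\<Union>(C I) = I" using bspec[OF C I] by simp_all
    show "J \<subseteq> I" if "J \<in> C I" for J using bspec[OF C I] that by simp
    show "emeasure M (J \<inter> K) = 0" if "J \<in> C I" "K \<in> C I" "J \<noteq> K" for J K
      using bspec[OF C I] that by (auto simp: pairwise_def almost_disjoint_def)
  qed (rule T levels)+
  have "bellman M T p q f A F = ennreal (a powr p * F)"
  proof (rule antisym)
    show "bellman M T p q f A F \<le> ennreal (a powr p * F)"
      unfolding bellman_def
    proof (rule Sup_least, safe)
      fix \<phi> :: "'a \<Rightarrow> real"
      assume \<phi>: "\<forall>x\<in>space M. 0 \<le> \<phi> x" "\<phi> \<in> borel_measurable M" "integrable M (\<lambda>x. \<bar>\<phi> x\<bar> powr p)"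
        "f = expectation \<phi>" "A = (\<integral>x. \<phi> x powr q \<partial>M)" "F = (\<integral>x. \<phi> x powr p \<partial>M)"
      \<comment> \<open>The Bochner integral of a non-integrable function is 0 by convention, but
        here it equals \<open>f > 0\<close>.\<close>
      have "integrable M \<phi>" using \<phi>(4) assms(6) not_integrable_integral_eq by force
      moreover have "integrable M (\<lambda>x. \<phi> x powr p)"
        by (rule Bochner_Integration.integrable_cong[OF refl, THEN iffD1, OF _ \<phi>(3)]) (simp add: \<phi>(1))
      ultimately show "(\<integral>\<^sup>+x. ennreal_powr (maximal_op M T \<phi> x) p \<partial>M) \<le> ennreal (a powr p * (\<integral>x. \<phi> x powr p \<partial>M))"
        using \<phi> p a ap(2) F assms(6)
        by (intro nn_integral_maximal_op_le[where f = f]) auto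
    qed
    define \<rho> where "\<rho> b = (1 - b) / (1 - b powr (1 / a)) * b powr (1 - 1 / a)" for b
    have lower: "ennreal (\<rho> b powr p * F) \<le> bellman M T p q f A F" if b: "0 < b" "b < 1" for b
    proof -
      obtain \<phi> :: "'a \<Rightarrow> real" where \<phi>: "\<phi> \<in> borel_measurable M" "\<And>x. 0 \<le> \<phi> x"
        and moment: "\<And>s. 0 \<le> s \<Longrightarrow> s \<le> p \<Longrightarrow> (\<integral>\<^sup>+x. ennreal (\<phi> x powr s) \<partial>M) = ennreal (f powr s / H_fun s a)"
        and max: "AE x in M. ennreal (\<rho> b * \<phi> x) \<le> maximal_op M T \<phi> x"
        using exists_near_extremal[OF a assms(6) b p pa] unfolding \<rho>_def by blast
      note [measurable] = \<phi>(1)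
      have moments: "integrable M (\<lambda>x. \<phi> x powr s) \<and> (\<integral>x. \<phi> x powr s \<partial>M) = v"
        if "0 \<le> s" "s \<le> p" "v = f powr s / H_fun s a" "0 < v" for s v
        using moment[OF that(1,2)] that(3,4)
        by (simp add: integrable_iff_bounded integral_eq_nn_integral)
      have m1: "expectation \<phi> = f"
        using moments[of 1 f] p H1 assms(6) \<phi>(2) by simp
      have mq: "(\<integral>x. \<phi> x powr q \<partial>M) = A" using moments[of q A] assms(1,2) Hq A by simp
      have mp: "integrable M (\<lambda>x. \<phi> x powr p)" "(\<integral>x. \<phi> x powr p \<partial>M) = F" using moments[of p F] p Hp F by auto
      have "b powr (1 / a) < 1" using b a powr_less_mono2[of "1/a" b 1] by simp
      then have \<rho>: "0 \<le> \<rho> b" using b by (simp add: \<rho>_def)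
      have "ennreal (\<rho> b powr p * F) = (\<integral>\<^sup>+x. ennreal (\<rho> b powr p * \<phi> x powr p) \<partial>M)"
        using mp \<phi>(2) by (subst nn_integral_eq_integral) auto
      also have "\<dots> \<le> (\<integral>\<^sup>+x. ennreal_powr (maximal_op M T \<phi> x) p \<partial>M)"
      proof (rule nn_integral_mono_AE)
        show "AE x in M. ennreal (\<rho> b powr p * \<phi> x powr p) \<le> ennreal_powr (maximal_op M T \<phi> x) p"
          using max
        proof eventually_elim
          case (elim x)
          show ?case
          proof (cases "maximal_op M T \<phi> x")
            case (real r)
            then have "\<rho> b * \<phi> x \<le> r" using elim by simp
            then have "(\<rho> b * \<phi> x) powr p \<le> r powr p" using p \<rho> \<phi>(2)[of x] by (intro powr_mono2) auto
            then show ?thesis using real \<rho> \<phi>(2)[of x] by (simp add: ennreal_powr_def powr_mult ennreal_leI)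
          qed (simp add: ennreal_powr_def)
        qed
      qed
      also have "\<dots> \<le> bellman M T p q f A F"
        unfolding bellman_def using \<phi> m1 mq mp by (intro Sup_upper) auto
      finally show ?thesis .
    qed
    \<comment> \<open>The supremum need not be attained by these functions; the bound is reached
      only in the limit as \<open>b\<close> tends to 1 from below.\<close>
    have "((\<lambda>b. \<rho> b powr p * F) \<longlongrightarrow> a powr p * F) (at_left 1)"
      unfolding \<rho>_def using a p by (intro tendsto_intros extremal_ratio_tendsto) auto
    then have "((\<lambda>b. ennreal (\<rho> b powr p * F)) \<longlongrightarrow> ennreal (a powr p * F)) (at_left 1)"
      by (rule tendsto_ennrealI)
    moreover have "eventually (\<lambda>b. ennreal (\<rho> b powr p * F) \<le> bellman M T p q f A F) (at_left 1)"
      using eventually_at_left_real[of 0 1] by (auto elim!: eventually_mono intro: lower)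
    ultimately show "ennreal (a powr p * F) \<le> bellman M T p q f A F"
      by (rule tendsto_upperbound) simp
  qed
  then show ?thesis by (simp add: a_def)
qed

end
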